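(* Let $v_1,\dots,v_m\in\mathbb{R}^n$, $x\in[0,1]^m$ and $c\in\mathbb{R}^m_+$. Suppose $\|\sum_{i=1}^mx_iv_iv_i^T\|_{\mathrm{op}}\le\lambda$ and $\|v_i\|\le l$ for $1\le i\le m$. Suppose further that $c_\infty\le l^2\langle c,x\rangle/\lambda$ and $l\le\sqrt\lambda$. Then there exists $z\in\{0,1\}^m$ such that \[\Big\|\sum_{i=1}^mx_iv_iv_i^T-\sum_{i=1}^mz_iv_iv_i^T\Big\|_{\mathrm{op}}\le8l\sqrt\lambda\quad\text{and}\quad|\langle c,x\rangle-\langle c,z\rangle|\le\frac{8l}{\sqrt\lambda}\langle c,x\rangle.\]
   Context: $\|\cdot\|_{\mathrm{op}}$ is the operator norm, $\|v_i\|$ the Euclidean norm, $c_\infty=\max_ic_i$. *)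

theory Defs
  imports "HOL-Analysis.Analysis"
begin

definition outer :: "real ^ 'n \<Rightarrow> real ^ 'n ^ 'n" where
  "outer v = (\<chi> a b. v $ a * v $ b)"  (* v v^T *)

(* The norm that the library puts on real^'n^'n is the Frobenius norm,
   so the l2 operator norm has to go through onorm. *)
definition op_norm :: "real ^ 'n ^ 'n \<Rightarrow> real" where
  "op_norm A = onorm (\<lambda>w. A *v w)"

end

theory Submission
  imports Defs "HOL-Complex_Analysis.Great_Picard"
begin

text \<open>
  Appending the coordinate \<open>sqrt (k c\<^sub>i)\<close> with \<open>k = lam / \<langle>c, x\<rangle>\<close> to \<open>v\<^sub>i\<close> turns the linear constraint
  into a diagonal entry of the matrix constraint, at the price of doubling \<open>l\<^sup>2\<close> and \<open>lam\<close>. It remains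
  to round a sum of rank-one matrices, which is done by the method of interlacing polynomials (Marcus,
  Spielman and Srivastava; Kyng, Luh and Song). Let \<open>S\<close> be the sum of the matrices
  \<open>(z\<^sub>i - x\<^sub>i) w\<^sub>i w\<^sub>i\<^sup>T\<close> for independent \<open>z\<^sub>i\<close> with mean \<open>x\<^sub>i\<close>. The expectation of \<open>det (t - S) det (t + S)\<close>
  over any subset of the variables is real-rooted, and so are all the mixtures obtained by changing the
  law of one variable; hence the variables can be fixed one by one without increasing the largest root.

  The largest root of the full expectation is bounded by a barrier argument: averaging over one variable
  is the operator \<open>1 - p (1 - p) / 2 * \<partial>\<^sup>2\<close>, and the increase of the logarithmic derivatives it
  causes is undone by a shift by \<open>p (1 - p) \<phi>\<close> in the same direction, where \<open>\<phi>\<close> bounds the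
  logarithmic derivatives. Since \<open>w w\<^sup>T\<close> has rank one, everything is quadratic in each
  direction, so that stability only enters through explicit inequalities between six coefficients.
\<close>

no_notation fps_nth (infixl "$" 75)

section \<open>Mixed characteristic polynomials\<close>

text \<open>Row \<open>k\<close> is \<open>v\<close> itself, so adding multiples of \<open>v\<close>
  to other rows is a sequence of elementary row operations.\<close>

lemma det_replaced_row_update:
  fixes M :: "'a::comm_ring_1^'n^'n" and v :: "'a^'n"
  assumes "finite K" "k \<notin> K"
  shows "det (\<chi> i. if i = k then v else if i \<in> K then M $ i + c i *s v else M $ i) =
    det (\<chi> i. if i = k then v else M $ i)"
  using assms
proof (induction K rule: finite_induct)
  case empty
  then show ?case by (simp cong: if_cong)
next
  case (insert j K)
  let ?A = "\<chi> i. if i = k then v else if i \<in> K then M $ i + c i *s v else M $ i"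
  have "j \<noteq> k" using insert by auto
  have "(\<chi> i. if i = k then v else if i \<in> insert j K then M $ i + c i *s v else M $ i) =
      (\<chi> i. if i = j then row j ?A + c j *s row k ?A else row i ?A)"
    using insert \<open>j \<noteq> k\<close> by (auto simp: vec_eq_iff row_def)
  then show ?case
    using det_row_operation[OF \<open>j \<noteq> k\<close>, of ?A "c j"] insert by simp
qed

text \<open>Multilinearity, one row at a time: terms in which two rows become multiples of
  \<open>v\<close> vanish. This is an inverse-free matrix determinant lemma, so it also covers
  singular \<open>M\<close>.\<close>

lemma det_rows_update:
  fixes M :: "'a::comm_ring_1^'n^'n" and v :: "'a^'n"
  assumes "finite K"
  shows "det (\<chi> i. if i \<in> K then M $ i + c i *s v else M $ i) =
    det M + (\<Sum>k\<in>K. c k * det (\<chi> i. if i = k then v else M $ i))"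
  using assms
proof (induction K rule: finite_induct)
  case empty
  then show ?case by simp
next
  case (insert k K)
  let ?R = "\<lambda>i. if i \<in> K then M $ i + c i *s v else M $ i"
  have "(\<chi> i. if i \<in> insert k K then M $ i + c i *s v else M $ i) =
      (\<chi> i. if i = k then M $ i + c i *s v else ?R i)"
    by (auto simp: vec_eq_iff)
  then have "det (\<chi> i. if i \<in> insert k K then M $ i + c i *s v else M $ i) =
      det (\<chi> i. if i = k then M $ i else ?R i) + det (\<chi> i. if i = k then c i *s v else ?R i)"
    by (simp only: det_row_add)
  also have "(\<chi> i. if i = k then M $ i else ?R i) = (\<chi> i. ?R i)"
    using insert by (auto simp: vec_eq_iff)
  also have "det (\<chi> i. if i = k then c i *s v else ?R i) = c k * det (\<chi> i. if i = k then v else ?R i)"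
  proof -
    have "(\<chi> i. if i = k then c i *s v else ?R i) = (\<chi> i. if i = k then c k *s v else ?R i)"
      by (auto simp: vec_eq_iff)
    then show ?thesis by (simp only: det_row_mul)
  qed
  finally show ?case
    using insert det_replaced_row_update[of K k v M c] by (simp add: add_ac)
qed

text \<open>The vector stays real while the coefficient may be complex: shifts along a fixed real
  direction can then be continued to complex parameters.\<close>

definition rk :: "'a::real_field \<Rightarrow> real^'n \<Rightarrow> 'a^'n^'n" where
  "rk a v = (\<chi> i j. a * of_real (v $ i * v $ j))"

lemma det_rk_affine:
  fixes M :: "'a::real_field^'n^'n"
  shows "\<exists>e. \<forall>z. det (M + rk z v) = det M + e * z"
proof -
  let ?v = "(\<chi> j. of_real (v $ j)) :: 'a^'n"
  have "M + rk z v = (\<chi> i. if i \<in> UNIV then M $ i + (z * of_real (v $ i)) *s ?v else M $ i)" for z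
    by (simp add: vec_eq_iff rk_def mult_ac)
  then have "det (M + rk z v) =
      det M + (\<Sum>k\<in>UNIV. of_real (v $ k) * det (\<chi> i. if i = k then ?v else M $ i)) * z" for z
    by (simp only: det_rows_update[OF finite_class.finite_UNIV]) (simp add: sum_distrib_left sum_distrib_right mult_ac)
  then show ?thesis by blast
qed

lemma rk_add: "rk (a + b) v = rk a v + rk b v"
  by (simp add: rk_def vec_eq_iff algebra_simps)

lemma rk_minus: "rk (- a) v = - rk a v"
  by (simp add: rk_def vec_eq_iff)

lemma rk_0 [simp]: "rk 0 v = 0"
  by (simp add: rk_def vec_eq_iff)

text \<open>The expectation of \<open>det (M + S) * det (N - S)\<close>, where \<open>S\<close> is the sum of the independent centred
  random matrices \<open>\<xi> v v\<^sup>T\<close> with \<open>\<xi> = 1 - p\<close> with probability \<open>p\<close> and \<open>\<xi> = - p\<close> otherwise.\<close>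

fun mixed :: "(real \<times> (real^'n)) list \<Rightarrow> 'a::real_field^'n^'n \<Rightarrow> 'a^'n^'n \<Rightarrow> 'a" where
  "mixed [] M N = det M * det N"
| "mixed ((p, v) # L) M N =
     of_real p * mixed L (M + rk (of_real (1 - p)) v) (N - rk (of_real (1 - p)) v)
     + of_real (1 - p) * mixed L (M - rk (of_real p) v) (N + rk (of_real p) v)"

text \<open>The recursion only shifts the two arguments, and at its end each determinant is affine
  in its own coefficient. Keeping \<open>y\<close> and \<open>z\<close> independent allows the
  opposite shifts of an outcome to be compared with a common shift.\<close>

lemma mixed_biaffine:
  fixes M N :: "'a::real_field^'n^'n"
  shows "\<exists>a b c d. \<forall>y z. mixed L (M + rk y v) (N + rk z v) = a + b * y + c * z + d * (y * z)"
proof (induction L arbitrary: M N)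
  case Nil
  obtain e1 e2 where "\<And>z. det (M + rk z v) = det M + e1 * z" "\<And>z. det (N + rk z v) = det N + e2 * z"
    using det_rk_affine by metis
  then have "\<forall>y z. mixed [] (M + rk y v) (N + rk z v) =
      det M * det N + (e1 * det N) * y + (det M * e2) * z + (e1 * e2) * (y * z)"
    by (simp add: algebra_simps)
  then show ?case by blast
next
  case (Cons x L)
  obtain p u where x: "x = (p, u)" by force
  let ?r = "\<lambda>q. rk (of_real q) u :: 'a^'n^'n"
  obtain a b c d where 1: "\<And>y z. mixed L ((M + ?r (1 - p)) + rk y v) ((N - ?r (1 - p)) + rk z v)
      = a + b * y + c * z + d * (y * z)"
    using Cons by blast
  obtain a' b' c' d' where 2: "\<And>y z. mixed L ((M - ?r p) + rk y v) ((N + ?r p) + rk z v)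
      = a' + b' * y + c' * z + d' * (y * z)"
    using Cons by blast
  have r: "A + B - C = A - C + B" "A + B + C = A + C + B" for A B C :: "'a^'n^'n"
    by simp_all
  have "mixed (x # L) (M + rk y v) (N + rk z v) =
      of_real p * (a + b * y + c * z + d * (y * z)) + of_real (1 - p) * (a' + b' * y + c' * z + d' * (y * z))"
    for y z
    unfolding x mixed.simps 1[symmetric] 2[symmetric]
    by (simp only: r[of M "rk y v"] r[of N "rk z v"])
  then have "\<forall>y z. mixed (x # L) (M + rk y v) (N + rk z v) =
      (of_real p * a + of_real (1 - p) * a') + (of_real p * b + of_real (1 - p) * b') * y
      + (of_real p * c + of_real (1 - p) * c') * z + (of_real p * d + of_real (1 - p) * d') * (y * z)"
    by (simp add: algebra_simps)
  then show ?case by blast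
qed

lemma quadratic_coeffs_unique:
  fixes a b c :: "'a::field_char_0"
  assumes "\<And>u. a + b * u + c * u\<^sup>2 = a' + b' * u + c' * u\<^sup>2"
  shows "a = a'" "b = b'" "c = c'"
proof -
  show a: "a = a'" using assms[of 0] by simp
  have 1: "b + c = b' + c'" "- b + c = - b' + c'" using assms[of 1] assms[of "-1"] a by simp_all
  have "2 * c = (b + c) + (- b + c)" by simp
  also have "\<dots> = 2 * c'" unfolding 1 by simp
  finally show "c = c'" by simp
  then show "b = b'" using 1 by simp
qed

lemma mixed_quadratic:
  fixes M N :: "'a::real_field^'n^'n"
  shows "\<exists>a b c. \<forall>u. mixed L (M + rk u v) (N + rk u v) = a + b * u + c * u\<^sup>2"
proof -
  obtain a b c d where "\<And>y z. mixed L (M + rk y v) (N + rk z v) = a + b * y + c * z + d * (y * z)"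
    using mixed_biaffine by metis
  then have "\<forall>u. mixed L (M + rk u v) (N + rk u v) = a + (b + c) * u + d * u\<^sup>2"
    by (simp add: algebra_simps power2_eq_square)
  then show ?thesis by blast
qed

text \<open>Averaging over one variable is the operator \<open>1 - p (1 - p) / 2 * \<partial>\<^sup>2\<close> in the direction \<open>v v\<^sup>T\<close>.\<close>

lemma mixed_Cons_eq:
  fixes M N :: "'a::real_field^'n^'n"
  assumes "\<And>u. mixed L (M + rk u v) (N + rk u v) = g0 + g1 * u + g2 * u\<^sup>2"
  shows "mixed ((p, v) # L) M N = g0 - of_real (p * (1 - p)) * g2"
proof -
  obtain a b c d where *: "\<And>y z. mixed L (M + rk y v) (N + rk z v) = a + b * y + c * z + d * (y * z)"
    using mixed_biaffine by metis
  have "a + (b + c) * u + d * u\<^sup>2 = g0 + g1 * u + g2 * u\<^sup>2" for u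
    using *[of u u] assms[of u] by (simp add: algebra_simps power2_eq_square)
  note eq = quadratic_coeffs_unique[OF this]
  have "mixed ((p, v) # L) M N =
      of_real p * mixed L (M + rk (of_real (1 - p)) v) (N + rk (- of_real (1 - p)) v)
     + of_real (1 - p) * mixed L (M + rk (- of_real p) v) (N + rk (of_real p) v)"
    by (simp add: rk_minus del: of_real_diff)
  \<comment> \<open>The linear terms average out because the law is centred; the product of the two
    opposite shifts has mean \<open>- p * (1 - p)\<close>.\<close>
  also have "\<dots> = a - of_real (p * (1 - p)) * d"
    unfolding * by (simp add: algebra_simps)
  finally show ?thesis using eq by simp
qed

section \<open>Complex matrices with positive definite imaginary part, and stability\<close>

definition cplx :: "real^'n^'n \<Rightarrow> real^'n^'n \<Rightarrow> complex^'n^'n" where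
  "cplx X Y = (\<chi> i j. Complex (X $ i $ j) (Y $ i $ j))"

lemma cplx_add_rk: "cplx X Y + rk z v = cplx (X + rk (Re z) v) (Y + rk (Im z) v)"
  by (simp add: cplx_def rk_def vec_eq_iff complex_eq_iff)

lemma cplx_diff_rk: "cplx X Y - rk z v = cplx (X - rk (Re z) v) (Y - rk (Im z) v)"
  by (simp add: cplx_def rk_def vec_eq_iff complex_eq_iff)

lemma det_cplx_0: "det (cplx X 0) = complex_of_real (det X)"
  by (simp add: det_def cplx_def complex_of_real_def[symmetric])

lemma mixed_cplx_0: "mixed L (cplx X 0) (cplx Y 0) = complex_of_real (mixed L X Y)"
proof (induction L arbitrary: X Y)
  case Nil
  then show ?case by (simp add: det_cplx_0)
next
  case (Cons x L)
  then show ?case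
    by (cases x) (simp add: cplx_add_rk cplx_diff_rk del: of_real_diff)
qed

lemma det_cplx_cnj: "det (cplx X (- Y)) = cnj (det (cplx X Y))"
proof -
  have "Complex a (- b) = cnj (Complex a b)" for a b by (simp add: complex_eq_iff)
  then show ?thesis by (simp add: det_def cplx_def)
qed

lemma mixed_cplx_cnj: "mixed L (cplx X (- Y)) (cplx X' (- Y')) = cnj (mixed L (cplx X Y) (cplx X' Y'))"
proof (induction L arbitrary: X X')
  case Nil
  then show ?case by (simp add: det_cplx_cnj)
next
  case (Cons x L)
  then show ?case
    by (cases x) (simp add: cplx_add_rk cplx_diff_rk del: of_real_diff)
qed

definition pos_def :: "real^'n^'n \<Rightarrow> bool" where
  "pos_def Y \<longleftrightarrow> (\<forall>w. w \<noteq> 0 \<longrightarrow> w \<bullet> (Y *v w) > 0)"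

definition symm :: "real^'n^'n \<Rightarrow> bool" where
  "symm X \<longleftrightarrow> (\<forall>i j. X $ i $ j = X $ j $ i)"

lemma symm_inner: "symm X \<Longrightarrow> a \<bullet> (X *v b) = b \<bullet> (X *v a)"
proof -
  assume "symm X"
  then have "transpose X = X" by (simp add: symm_def transpose_def vec_eq_iff)
  then show ?thesis by (metis dot_lmul_matrix inner_commute vector_transpose_matrix)
qed

lemma rk_quadratic_form: "w \<bullet> (rk a v *v w) = a * (v \<bullet> w)\<^sup>2"
proof -
  have "rk a v *v w = (a * (v \<bullet> w)) *\<^sub>R v"
    by (simp add: rk_def vec_eq_iff matrix_vector_mult_def inner_vec_def sum_distrib_left mult_ac)
  then show ?thesis by (simp add: inner_commute power2_eq_square)
qed

lemma symm_rk [simp]: "symm (rk a v)"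
  by (simp add: symm_def rk_def mult_ac)

lemma symm_add [intro]: "symm X \<Longrightarrow> symm Y \<Longrightarrow> symm (X + Y)"
  by (simp add: symm_def)

lemma symm_diff [intro]: "symm X \<Longrightarrow> symm Y \<Longrightarrow> symm (X - Y)"
  by (simp add: symm_def)

lemma pos_def_add_rk: "pos_def Y \<Longrightarrow> a \<ge> 0 \<Longrightarrow> pos_def (Y + rk a v)"
  by (auto simp: pos_def_def matrix_vector_mult_add_rdistrib inner_add_right rk_quadratic_form
      intro!: add_pos_nonneg)

lemma det_eq_0_iff_kernel:
  fixes A :: "'a::field^'n^'n"
  shows "det A = 0 \<longleftrightarrow> (\<exists>w. w \<noteq> 0 \<and> A *v w = 0)"
proof -
  have "det A = 0 \<longleftrightarrow> \<not> (\<exists>B. B ** A = mat 1)"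
    by (metis invertible_det_nz invertible_left_inverse)
  then show ?thesis unfolding matrix_left_invertible_ker by blast
qed

text \<open>For a kernel vector \<open>a + i b\<close>, splitting into real and imaginary parts and
  cancelling the cross terms by symmetry of \<open>X\<close> leaves
  \<open>a \<bullet> (Y *v a) + b \<bullet> (Y *v b) = 0\<close>.\<close>

lemma det_cplx_nonzero:
  assumes "symm X" "pos_def Y"
  shows "det (cplx X Y) \<noteq> 0"
proof
  assume "det (cplx X Y) = 0"
  then obtain w where w: "cplx X Y *v w = 0" "w \<noteq> 0"
    unfolding det_eq_0_iff_kernel by blast
  define a b where "a = (\<chi> i. Re (w $ i))" and "b = (\<chi> i. Im (w $ i))"
  have "X *v a - Y *v b = (\<chi> i. Re ((cplx X Y *v w) $ i))"
    by (simp add: vec_eq_iff matrix_vector_mult_def cplx_def a_def b_def sum_subtractf)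
  then have 1: "X *v a = Y *v b" by (simp add: w zero_vec_def[symmetric])
  have "X *v b + Y *v a = (\<chi> i. Im ((cplx X Y *v w) $ i))"
    by (simp add: vec_eq_iff matrix_vector_mult_def cplx_def a_def b_def sum.distrib)
  then have 2: "Y *v a = - (X *v b)" by (simp add: w zero_vec_def[symmetric] eq_neg_iff_add_eq_0 add.commute)
  have "a \<bullet> (Y *v a) + b \<bullet> (Y *v b) = 0"
    unfolding 2 1[symmetric] using symm_inner[OF assms(1), of a b] by simp
  then have "a = 0 \<and> b = 0"
    using assms(2) unfolding pos_def_def
    by (smt (verit) inner_zero_left)
  then have "w = 0"
    by (simp add: a_def b_def vec_eq_iff complex_eq_iff)
  with w show False by simp
qed

text \<open>The product of the two zeros is a nonnegative real, so they cannot both lie in the open lower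
  half-plane.\<close>

lemma quadratic_upper_half_plane:
  fixes g0 g1 g2 :: complex
  assumes "\<And>u. Im u \<ge> 0 \<Longrightarrow> g0 + g1 * u + g2 * u\<^sup>2 \<noteq> 0" and "t \<ge> 0"
  shows "g0 - of_real t * g2 \<noteq> 0"
proof
  assume *: "g0 - of_real t * g2 = 0"
  have "g0 \<noteq> 0" using assms(1)[of 0] by simp
  with * have "g2 \<noteq> 0" by auto
  define q where "q = g1 / g2"
  define s where "s = csqrt (q\<^sup>2 - 4 * of_real t)"
  define r where "r = (- q + s) / 2"
  define r' where "r' = (- q - s) / 2"
  have s: "s\<^sup>2 = q\<^sup>2 - 4 * of_real t" by (simp add: s_def)
  have sum: "r + r' = - q" by (simp add: r_def r'_def field_simps)
  have "r * r' = (q\<^sup>2 - s\<^sup>2) / 4"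
    unfolding r_def r'_def by (simp add: field_simps power2_eq_square)
  then have prod: "r * r' = of_real t" by (simp add: s)
  have fact: "g0 + g1 * u + g2 * u\<^sup>2 = g2 * ((u - r) * (u - r'))" for u
  proof -
    have "g2 * ((u - r) * (u - r')) = g2 * u\<^sup>2 - g2 * (r + r') * u + g2 * (r * r')"
      by (simp add: algebra_simps power2_eq_square)
    also have "\<dots> = g2 * u\<^sup>2 + g1 * u + g0" using * \<open>g2 \<noteq> 0\<close> by (simp add: sum prod q_def)
    finally show ?thesis by simp
  qed
  have "Im r < 0" using assms(1)[of r] fact[of r] by fastforce
  moreover have "Im r' < 0" using assms(1)[of r'] fact[of r'] by fastforce
  moreover have "r' = of_real (t / (cmod r)\<^sup>2) * cnj r"
  proof -
    have "r * (of_real (t / (cmod r)\<^sup>2) * cnj r) = of_real (t / (cmod r)\<^sup>2) * (r * cnj r)" by simp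
    also have "r * cnj r = of_real ((cmod r)\<^sup>2)" by (metis complex_norm_square)
    also have "of_real (t / (cmod r)\<^sup>2) * of_real ((cmod r)\<^sup>2) = complex_of_real t"
      using \<open>Im r < 0\<close> by (auto simp flip: of_real_mult)
    finally show ?thesis using prod \<open>Im r < 0\<close>
      by (metis mult_left_cancel less_irrefl zero_complex.simps(2))
  qed
  then have "Im r' = t / (cmod r)\<^sup>2 * (- Im r)"
    by (simp add: times_complex.sel)
  ultimately show False
    using assms(2) by (smt (verit) divide_nonneg_nonneg mult_nonneg_nonneg zero_le_power2)
qed

text \<open>A common shift by \<open>u\<close> with \<open>Im u \<ge> 0\<close> keeps both imaginary
  parts positive definite, so the polynomial of the shorter list has no zero there;
  \<open>quadratic_upper_half_plane\<close> with \<open>t = p * (1 - p)\<close> passes this on to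
  the longer list.\<close>

lemma mixed_stable:
  assumes "symm X" "symm X'" "pos_def Y" "pos_def Y'" "\<forall>(p, v) \<in> set L. 0 \<le> p \<and> p \<le> 1"
  shows "mixed L (cplx X Y) (cplx X' Y') \<noteq> 0"
  using assms
proof (induction L arbitrary: X X' Y Y')
  case Nil
  then show ?case by (simp add: det_cplx_nonzero)
next
  case (Cons x L)
  obtain p v where x: "x = (p, v)" by force
  obtain a b c where *: "\<And>u. mixed L (cplx X Y + rk u v) (cplx X' Y' + rk u v) = a + b * u + c * u\<^sup>2"
    using mixed_quadratic by metis
  have "a + b * u + c * u\<^sup>2 \<noteq> 0" if "Im u \<ge> 0" for u
    unfolding *[symmetric] cplx_add_rk
    using Cons that by (intro Cons.IH) (auto intro: pos_def_add_rk)
  then have "a - of_real (p * (1 - p)) * c \<noteq> 0"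
    using Cons.prems(5) by (intro quadratic_upper_half_plane) (auto simp: x)
  then show ?case unfolding x mixed_Cons_eq[OF *] .
qed

section \<open>Logarithmic derivatives\<close>

lemma continuous_on_mixed:
  fixes F G :: "real \<Rightarrow> complex^'n^'n"
  assumes "\<And>i j. continuous_on S (\<lambda>x. F x $ i $ j)" "\<And>i j. continuous_on S (\<lambda>x. G x $ i $ j)"
  shows "continuous_on S (\<lambda>x. mixed L (F x) (G x))"
  using assms
proof (induction L arbitrary: F G)
  case Nil
  then show ?case unfolding mixed.simps det_def
    by (intro continuous_on_mult continuous_on_sum continuous_on_prod continuous_on_const) auto
next
  case (Cons x L)
  obtain p v where x: "x = (p, v)" by force
  show ?case unfolding x mixed.simps
    using Cons.prems by (intro continuous_on_add continuous_on_mult continuous_on_const Cons.IH) (auto intro!: continuous_on_add continuous_on_diff)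
qed

text \<open>The reciprocals of the zeros of \<open>A + B w + C w\<^sup>2\<close> lie in the closed upper half-plane, and
  their sum is \<open>- B / A\<close>.\<close>

lemma half_plane_linear_coeff:
  fixes A B C :: complex
  assumes "\<And>w. Im w \<ge> 0 \<Longrightarrow> A + B * w + C * w\<^sup>2 \<noteq> 0"
  shows "Im (B * cnj A) \<le> 0"
proof -
  have "A \<noteq> 0" using assms[of 0] by simp
  define n where "n = B / A"
  define e where "e = C / A"
  define s where "s = csqrt (n\<^sup>2 - 4 * e)"
  have s: "s\<^sup>2 = n\<^sup>2 - 4 * e" by (simp add: s_def)
  \<comment> \<open>Reciprocals make the degenerate case \<open>C = 0\<close> uniform: a missing
    zero simply becomes the root \<open>0\<close>.\<close>
  have pos: "Im r \<ge> 0" if "r\<^sup>2 + n * r + e = 0" for r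
  proof (rule ccontr)
    assume neg: "\<not> Im r \<ge> 0"
    then have "r \<noteq> 0" by auto
    have "A + B * inverse r + C * (inverse r)\<^sup>2 = A * (inverse r)\<^sup>2 * (r\<^sup>2 + n * r + e)"
      using \<open>r \<noteq> 0\<close> \<open>A \<noteq> 0\<close> by (simp add: n_def e_def field_simps power2_eq_square)
    moreover have "Im (inverse r) \<ge> 0"
      using neg by (simp add: divide_nonpos_nonneg)
    ultimately show False using assms[of "inverse r"] that by simp
  qed
  have "((- n + s) / 2)\<^sup>2 + n * ((- n + s) / 2) + e = (s\<^sup>2 - n\<^sup>2 + 4 * e) / 4"
    by (simp add: field_simps power2_eq_square)
  then have 1: "Im ((- n + s) / 2) \<ge> 0" by (intro pos) (simp add: s)
  have "((- n - s) / 2)\<^sup>2 + n * ((- n - s) / 2) + e = (s\<^sup>2 - n\<^sup>2 + 4 * e) / 4"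
    by (simp add: field_simps power2_eq_square)
  then have 2: "Im ((- n - s) / 2) \<ge> 0" by (intro pos) (simp add: s)
  have "Im n \<le> 0" using 1 2 by simp
  have "B * cnj A = n * (A * cnj A)" using \<open>A \<noteq> 0\<close> by (simp add: n_def)
  also have "\<dots> = of_real ((cmod A)\<^sup>2) * n" by (metis complex_norm_square mult.commute)
  finally have "Im (B * cnj A) = (cmod A)\<^sup>2 * Im n" by simp
  then show ?thesis using \<open>Im n \<le> 0\<close> by (simp add: mult_nonneg_nonpos)
qed

lemma quadratic_extend_to_complex:
  fixes G :: "complex \<Rightarrow> complex" and d0 d1 d2 :: real
  assumes "\<exists>a b c. \<forall>u. G u = a + b * u + c * u\<^sup>2"
    and "\<And>r::real. G (of_real r) = of_real (d0 + d1 * r + d2 * r\<^sup>2)"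
  shows "G u = of_real d0 + of_real d1 * u + of_real d2 * u\<^sup>2"
proof -
  obtain a b c where *: "\<And>u. G u = a + b * u + c * u\<^sup>2" using assms(1) by blast
  have a: "a = of_real d0" using *[of 0] assms(2)[of 0] by simp
  have 1: "a + b + c = of_real (d0 + d1 + d2)" using *[of 1] assms(2)[of 1] by simp
  have 2: "a - b + c = of_real (d0 - d1 + d2)" using *[of "-1"] assms(2)[of "-1"] by simp
  have "2 * b = (a + b + c) - (a - b + c)" by simp
  also have "\<dots> = 2 * of_real d1" unfolding 1 2 by simp
  finally have b: "b = of_real d1" by simp
  then have "c = of_real d2" using 1 a by simp
  then show ?thesis using * a b by simp
qed

lemma mat_quadratic_form: "w \<bullet> (mat k *v w) = k * (w \<bullet> w)" for w :: "real^'n"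
proof -
  have "mat k *v w = k *\<^sub>R w"
    by (simp add: vec_eq_iff matrix_vector_mult_def mat_def if_distrib if_distribR cong: if_cong)
  then show ?thesis by simp
qed

lemma symm_mat [simp]: "symm (mat k)"
  by (simp add: symm_def mat_def)

abbreviation valid :: "real \<Rightarrow> (real \<times> (real^'n)) list \<Rightarrow> bool" where
  "valid l L \<equiv> \<forall>(p, v) \<in> set L. 0 \<le> p \<and> p \<le> 1 \<and> norm v \<le> l"

text \<open>The quotient \<open>N / D\<close> is the logarithmic derivative in the direction \<open>v v\<^sup>T\<close>, as a function of
  the coordinate in the direction \<open>a a\<^sup>T\<close>; it maps the upper half-plane to the lower one.\<close>

lemma mixed_log_derivative_half_plane:
  assumes "symm M" "valid l L" "Im u > 0"
    and f: "\<And>u w::real. mixed L (M + rk u a + rk w v) (M + rk u a + rk w v) =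
      (D0 + D1 * u + D2 * u\<^sup>2) + (N0 + N1 * u + N2 * u\<^sup>2) * w + (E0 + E1 * u + E2 * u\<^sup>2) * w\<^sup>2"
  shows "Im ((of_real N0 + of_real N1 * u + of_real N2 * u\<^sup>2) *
    cnj (of_real D0 + of_real D1 * u + of_real D2 * u\<^sup>2)) \<le> 0"
proof -
  have G: "mixed L (cplx (M + rk r v) 0 + rk u a) (cplx (M + rk r v) 0 + rk u a) =
      of_real (D0 + N0 * r + E0 * r\<^sup>2) + of_real (D1 + N1 * r + E1 * r\<^sup>2) * u
        + of_real (D2 + N2 * r + E2 * r\<^sup>2) * u\<^sup>2" for r u
  proof (rule quadratic_extend_to_complex[where G = "\<lambda>u. mixed L (cplx (M + rk r v) 0 + rk u a) (cplx (M + rk r v) 0 + rk u a)"])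
    show "\<exists>a' b c. \<forall>u. mixed L (cplx (M + rk r v) 0 + rk u a) (cplx (M + rk r v) 0 + rk u a)
        = a' + b * u + c * u\<^sup>2"
      by (rule mixed_quadratic)
    fix t :: real
    have "M + rk r v + rk t a = M + rk t a + rk r v" by simp
    then show "mixed L (cplx (M + rk r v) 0 + rk (complex_of_real t) a)
       (cplx (M + rk r v) 0 + rk (complex_of_real t) a) =
        complex_of_real (D0 + N0 * r + E0 * r\<^sup>2 + (D1 + N1 * r + E1 * r\<^sup>2) * t + (D2 + N2 * r + E2 * r\<^sup>2) * t\<^sup>2)"
      by (simp only: cplx_add_rk Re_complex_of_real Im_complex_of_real rk_0 add_0_right mixed_cplx_0 f)
        (simp add: algebra_simps)
  qed
  \<comment> \<open>A rank-one imaginary part is only semidefinite in general. Adding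
    \<open>\<epsilon>\<close> times the identity makes stability applicable, and
    \<open>\<epsilon>\<close> tends to \<open>0\<close> at the end.\<close>
  define K where "K \<epsilon> w = cplx M (mat \<epsilon>) + rk u a + rk w v" for \<epsilon> w
  define H where "H \<epsilon> w = mixed L (K \<epsilon> w) (K \<epsilon> w)" for \<epsilon> w
  \<comment> \<open>The values at \<open>1\<close>, \<open>-1\<close> and \<open>0\<close> isolate
    the linear and the constant coefficient in \<open>w\<close>, in a form visibly continuous in
    \<open>\<epsilon>\<close>.\<close>
  define Q where "Q \<epsilon> = Im ((H \<epsilon> 1 - H \<epsilon> (- 1)) / 2 * cnj (H \<epsilon> 0))" for \<epsilon>
  have Q_le: "Q \<epsilon> \<le> 0" if "\<epsilon> > 0" for \<epsilon>
  proof -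
    obtain A B C where ABC: "\<And>w. H \<epsilon> w = A + B * w + C * w\<^sup>2"
      unfolding H_def K_def using mixed_quadratic by metis
    have "A + B * w + C * w\<^sup>2 \<noteq> 0" if "Im w \<ge> 0" for w
      unfolding ABC[symmetric] H_def K_def cplx_add_rk
      using \<open>\<epsilon> > 0\<close> that assms(1-3)
      by (intro mixed_stable pos_def_add_rk symm_add) (auto simp: pos_def_def mat_quadratic_form)
    then have "Im (B * cnj A) \<le> 0" by (rule half_plane_linear_coeff)
    then show ?thesis unfolding Q_def ABC by simp
  qed
  have "continuous_on UNIV (\<lambda>\<epsilon>. K \<epsilon> w $ i $ j)" for w i j
    by (cases "i = j") (auto simp: K_def cplx_def rk_def mat_def Complex_eq intro!: continuous_intros)
  then have "continuous_on UNIV (\<lambda>\<epsilon>. H \<epsilon> w)" for w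
    unfolding H_def by (intro continuous_on_mixed)
  then have "continuous_on UNIV Q"
    unfolding Q_def by (intro continuous_intros) auto
  then have "(Q \<longlongrightarrow> Q 0) (at_right 0)"
    by (meson continuous_on_def filterlim_at_split UNIV_I at_within_open open_UNIV)
  then have "Q 0 \<le> 0"
    by (rule tendsto_upperbound) (auto simp: eventually_at_right_field intro!: exI[of _ 1] Q_le)
  moreover have "H 0 (of_real r) = of_real (D0 + N0 * r + E0 * r\<^sup>2) + of_real (D1 + N1 * r + E1 * r\<^sup>2) * u
        + of_real (D2 + N2 * r + E2 * r\<^sup>2) * u\<^sup>2" for r
  proof -
    have "K 0 (of_real r) = cplx (M + rk r v) 0 + rk u a"
      by (simp add: K_def cplx_def rk_def vec_eq_iff complex_eq_iff mat_def zero_vec_def)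
    then show ?thesis unfolding H_def by (simp only: G)
  qed
  from this[of 0] this[of 1] this[of "-1"] have "H 0 0 = of_real D0 + of_real D1 * u + of_real D2 * u\<^sup>2"
    "(H 0 1 - H 0 (- 1)) / 2 = of_real N0 + of_real N1 * u + of_real N2 * u\<^sup>2"
    by (simp_all add: algebra_simps)
  ultimately show ?thesis unfolding Q_def by simp
qed

text \<open>Small \<open>y\<close> gives a quadratic polynomial in \<open>x\<close> that is nowhere
  positive, hence has nonpositive discriminant; large \<open>y\<close> at \<open>x = 0\<close>
  forces \<open>g \<le> 0\<close>.\<close>

lemma nonpos_quadratic_form:
  fixes a b g :: real
  assumes *: "\<And>x y. y > 0 \<Longrightarrow> a + 2 * x * b + (x\<^sup>2 + y\<^sup>2) * g \<le> 0"
  shows "a \<le> 0" "g \<le> 0" "b\<^sup>2 \<le> a * g"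
proof -
  show g: "g \<le> 0"
  proof (rule ccontr)
    assume "\<not> g \<le> 0"
    then have "g > 0" by simp
    have "(sqrt ((\<bar>a\<bar> + 1) / g))\<^sup>2 * g = \<bar>a\<bar> + 1" using \<open>g > 0\<close> by simp
    then show False using *[of "sqrt ((\<bar>a\<bar> + 1) / g)" 0] \<open>g > 0\<close> by simp
  qed
  have **: "a + 2 * x * b + x\<^sup>2 * g \<le> 0" for x
  proof (rule ccontr)
    assume "\<not> a + 2 * x * b + x\<^sup>2 * g \<le> 0"
    then have c: "a + 2 * x * b + x\<^sup>2 * g > 0" by simp
    show False
    proof (cases "g = 0")
      case True then show ?thesis using *[of 1 x] c by simp
    next
      case False
      then have "g < 0" using g by simp
      define y where "y = sqrt ((a + 2 * x * b + x\<^sup>2 * g) / (- 2 * g))"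
      have "y > 0" using c \<open>g < 0\<close> by (simp add: y_def divide_pos_neg)
      moreover have "y\<^sup>2 = (a + 2 * x * b + x\<^sup>2 * g) / (- 2 * g)"
        unfolding y_def using c \<open>g < 0\<close> by (intro real_sqrt_pow2 divide_nonneg_nonneg) auto
      then have "y\<^sup>2 * g = - (a + 2 * x * b + x\<^sup>2 * g) / 2" using \<open>g < 0\<close> by (simp add: field_simps)
      ultimately show ?thesis using *[of y x] c by (simp add: algebra_simps)
    qed
  qed
  show "a \<le> 0" using **[of 0] by simp
  show "b\<^sup>2 \<le> a * g"
  proof (cases "g = 0")
    case True
    have "b = 0"
    proof (rule ccontr)
      assume "b \<noteq> 0"
      then have "2 * ((1 - a) / (2 * b)) * b = 1 - a" by simp
      then show False using **[of "(1 - a) / (2 * b)"] True by simp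
    qed
    then show ?thesis using True by simp
  next
    case False
    then have "g < 0" using g by simp
    have "a - b\<^sup>2 / g \<le> 0" using **[of "- b / g"] False by (simp add: field_simps power2_eq_square)
    then show ?thesis using \<open>g < 0\<close> by (simp add: field_simps)
  qed
qed

text \<open>At \<open>u = x + i y\<close> the imaginary part of \<open>N\<close> times the conjugate
  of \<open>D\<close> is \<open>y\<close> times a form in the coefficients of the Wronskian
  \<open>N' D - N D'\<close>, so the half-plane property is semidefiniteness of that form.\<close>

lemma mixed_log_derivative_signs:
  assumes "symm M" "valid l L"
    and "\<And>u w::real. mixed L (M + rk u a + rk w v) (M + rk u a + rk w v) =
      (D0 + D1 * u + D2 * u\<^sup>2) + (N0 + N1 * u + N2 * u\<^sup>2) * w + (E0 + E1 * u + E2 * u\<^sup>2) * w\<^sup>2"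
  shows "N1 * D0 - N0 * D1 \<le> 0" "N2 * D1 - N1 * D2 \<le> 0"
    "(N2 * D0 - N0 * D2)\<^sup>2 \<le> (N1 * D0 - N0 * D1) * (N2 * D1 - N1 * D2)"
proof -
  have "(N1 * D0 - N0 * D1) + 2 * x * (N2 * D0 - N0 * D2) + (x\<^sup>2 + y\<^sup>2) * (N2 * D1 - N1 * D2) \<le> 0"
    if "y > 0" for x y
  proof -
    let ?u = "Complex x y"
    have "Im ((of_real N0 + of_real N1 * ?u + of_real N2 * ?u\<^sup>2) *
        cnj (of_real D0 + of_real D1 * ?u + of_real D2 * ?u\<^sup>2)) \<le> 0"
      using that by (intro mixed_log_derivative_half_plane[OF assms(1,2) _ assms(3)]) simp
    moreover have "Im ((of_real N0 + of_real N1 * ?u + of_real N2 * ?u\<^sup>2) *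
        cnj (of_real D0 + of_real D1 * ?u + of_real D2 * ?u\<^sup>2)) =
        y * ((N1 * D0 - N0 * D1) + 2 * x * (N2 * D0 - N0 * D2) + (x\<^sup>2 + y\<^sup>2) * (N2 * D1 - N1 * D2))"
      by (simp add: power2_eq_square algebra_simps)
    ultimately show ?thesis using that by (simp add: mult_le_0_iff)
  qed
  from nonpos_quadratic_form[OF this] show "N1 * D0 - N0 * D1 \<le> 0" "N2 * D1 - N1 * D2 \<le> 0"
    "(N2 * D0 - N0 * D2)\<^sup>2 \<le> (N1 * D0 - N0 * D1) * (N2 * D1 - N1 * D2)" by blast+
qed

text \<open>This is real-rootedness along \<open>v\<close>. With both directions equal to
  \<open>v\<close> the polynomial depends on \<open>u + w\<close> only, \<open>N\<close> is the
  derivative of \<open>D\<close>, and the third sign condition becomes the discriminant times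
  \<open>D2\<^sup>2\<close>.\<close>

lemma mixed_discriminant_nonneg:
  assumes "symm M" "valid l L"
    and "\<And>u::real. mixed L (M + rk u v) (M + rk u v) = D0 + D1 * u + D2 * u\<^sup>2"
  shows "4 * D0 * D2 \<le> D1\<^sup>2"
proof -
  have "mixed L (M + rk u v + rk w v) (M + rk u v + rk w v) = (D0 + D1 * u + D2 * u\<^sup>2)
      + (D1 + 2 * D2 * u + 0 * u\<^sup>2) * w + (D2 + 0 * u + 0 * u\<^sup>2) * w\<^sup>2" for u w
    using assms(3)[of "u + w"] by (simp add: rk_add add.assoc power2_eq_square algebra_simps)
  from mixed_log_derivative_signs(3)[OF assms(1,2) this]
  have "(D1\<^sup>2 - 4 * D0 * D2) * D2\<^sup>2 \<ge> 0" by (simp add: power2_eq_square algebra_simps)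
  then show ?thesis by (cases "D2 = 0") (simp_all add: zero_le_mult_iff)
qed

section \<open>The barrier argument\<close>

text \<open>The coefficients in \<open>w\<close> are linear combinations of the values at
  \<open>w = 0, 1, -1\<close>, each of which is quadratic in \<open>u\<close>.\<close>

lemma biquadratic_expansion:
  fixes f :: "real \<Rightarrow> real \<Rightarrow> real"
  assumes "\<And>u. \<exists>a b c. \<forall>w. f u w = a + b * w + c * w\<^sup>2"
    and "\<And>w. \<exists>a b c. \<forall>u. f u w = a + b * u + c * u\<^sup>2"
  obtains D0 D1 D2 N0 N1 N2 E0 E1 E2 where
    "\<And>u w. f u w = (D0 + D1 * u + D2 * u\<^sup>2) + (N0 + N1 * u + N2 * u\<^sup>2) * w + (E0 + E1 * u + E2 * u\<^sup>2) * w\<^sup>2"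
proof -
  obtain A B C where w: "\<And>u w. f u w = A u + B u * w + C u * w\<^sup>2"
    using assms(1) by metis
  obtain A' B' C' where u: "\<And>u w. f u w = A' w + B' w * u + C' w * u\<^sup>2"
    using assms(2) by metis
  have A: "A u = A' 0 + B' 0 * u + C' 0 * u\<^sup>2" for u
    using w[of u 0] u[of u 0] by simp
  have B: "B u = (A' 1 - A' (-1)) / 2 + (B' 1 - B' (-1)) / 2 * u + (C' 1 - C' (-1)) / 2 * u\<^sup>2" for u
  proof -
    have "B u = (f u 1 - f u (-1)) / 2" unfolding w by simp
    then show ?thesis unfolding u by (simp add: field_simps)
  qed
  have C: "C u = ((A' 1 + A' (-1)) / 2 - A' 0) + ((B' 1 + B' (-1)) / 2 - B' 0) * u
      + ((C' 1 + C' (-1)) / 2 - C' 0) * u\<^sup>2" for u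
  proof -
    have "C u = (f u 1 + f u (-1)) / 2 - f u 0" unfolding w by (simp add: field_simps)
    then show ?thesis unfolding u by (simp add: field_simps)
  qed
  show thesis using w A B C that by metis
qed

lemma quadratic_lead_nonneg:
  fixes A B C :: real
  assumes "\<And>w. w \<ge> 0 \<Longrightarrow> A + B * w + C * w\<^sup>2 > 0"
  shows "C \<ge> 0"
proof (rule ccontr)
  assume "\<not> C \<ge> 0"
  then have "C < 0" by simp
  have "A > 0" using assms[of 0] by simp
  define w where "w = 1 + (A + \<bar>B\<bar>) / (- C)"
  have "w \<ge> 1" unfolding w_def using \<open>C < 0\<close> \<open>A > 0\<close> by (simp add: divide_nonneg_neg)
  have "C * w = C - (A + \<bar>B\<bar>)" using \<open>C < 0\<close> by (simp add: w_def field_simps)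
  then have "C * w \<le> - A - B" using \<open>C < 0\<close> by simp
  then have "(C * w) * w \<le> (- A - B) * w" using \<open>w \<ge> 1\<close> by (intro mult_right_mono) auto
  moreover have "A \<le> A * w" using \<open>w \<ge> 1\<close> \<open>A > 0\<close> by simp
  ultimately have "A + B * w + C * w\<^sup>2 \<le> 0" by (simp add: power2_eq_square algebra_simps)
  then show False using assms[of w] \<open>w \<ge> 1\<close> by simp
qed

text \<open>If \<open>B < 0\<close>, then the real zero of the linear case, or the vertex
  \<open>- B / (2 * C)\<close> with its nonpositive value, would lie on the positive
  half-line.\<close>

lemma quadratic_linear_coeff_nonneg:
  fixes A B C :: real
  assumes *: "\<And>w. w \<ge> 0 \<Longrightarrow> A + B * w + C * w\<^sup>2 > 0" and "4 * A * C \<le> B\<^sup>2"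
  shows "B \<ge> 0"
proof (rule ccontr)
  assume "\<not> B \<ge> 0"
  then have "B < 0" by simp
  have "C \<ge> 0" using quadratic_lead_nonneg[OF *] by blast
  have "A > 0" using *[of 0] by simp
  show False
  proof (cases "C = 0")
    case True
    then show False using *[of "- A / B"] \<open>B < 0\<close> \<open>A > 0\<close> by (simp add: divide_nonneg_neg)
  next
    case False
    then have "C > 0" using \<open>C \<ge> 0\<close> by simp
    have "A + B * (- B / (2 * C)) + C * (- B / (2 * C))\<^sup>2 = A - B\<^sup>2 / (4 * C)"
      using \<open>C > 0\<close> by (simp add: field_simps power2_eq_square)
    moreover have "A - B\<^sup>2 / (4 * C) \<le> 0" using assms(2) \<open>C > 0\<close> by (simp add: field_simps)
    ultimately show False using *[of "- B / (2 * C)"] \<open>B < 0\<close> \<open>C > 0\<close> by (simp add: divide_nonpos_pos)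
  qed
qed

text \<open>The discriminant and \<open>D1 \<le> \<phi> * D0\<close> give
  \<open>4 * D2 \<le> \<phi> * D1\<close>, so the linear gain of the shift by
  \<open>t * \<phi>\<close> pays for the loss \<open>t * D2\<close>.\<close>

lemma barrier_step_pos:
  fixes D0 D1 D2 \<phi> t :: real
  assumes "D0 > 0" "D1 \<ge> 0" "D2 \<ge> 0" "4 * D0 * D2 \<le> D1\<^sup>2" "D1 \<le> \<phi> * D0" "t \<ge> 0" "\<phi> \<ge> 0"
  shows "D0 + D1 * (t * \<phi>) + D2 * (t * \<phi>)\<^sup>2 - t * D2 > 0"
proof -
  have "D1\<^sup>2 \<le> D1 * (\<phi> * D0)" using assms by (simp add: power2_eq_square mult_left_mono)
  then have "D0 * (4 * D2) \<le> D0 * (D1 * \<phi>)" using assms(4) by (simp add: mult_ac)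
  then have "4 * D2 \<le> D1 * \<phi>" using assms(1) by simp
  then have "t * D2 \<le> t * (D1 * \<phi>)" using assms by (intro mult_left_mono) auto
  then have "t * D2 \<le> D1 * (t * \<phi>)" by (simp add: mult_ac)
  moreover have "D2 * (t * \<phi>)\<^sup>2 \<ge> 0" using assms by simp
  ultimately show ?thesis using assms(1) by linarith
qed

text \<open>Convexity of \<open>N / D\<close> to the right of the zeros enters as \<open>\<beta> D\<^sub>0 \<ge> \<alpha> D\<^sub>1\<close>, where \<open>\<alpha>, \<beta>, \<gamma>\<close> are the
  coefficients of the Wronskian. It comes from \<open>\<beta>\<^sup>2 \<le> \<alpha> \<gamma>\<close> and the Pluecker relation
  \<open>D\<^sub>0 \<gamma> = D\<^sub>1 \<beta> - D\<^sub>2 \<alpha>\<close>.\<close>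

lemma barrier_step_deriv:
  fixes D0 D1 D2 N0 N1 N2 \<phi> t :: real
  assumes D: "D0 > 0" "D1 \<ge> 0" "D2 \<ge> 0" "4 * D0 * D2 \<le> D1\<^sup>2" "D1 \<le> \<phi> * D0" and t: "t \<ge> 0" and \<phi>: "\<phi> \<ge> 0"
    and \<alpha>: "N1 * D0 - N0 * D1 \<le> 0" and \<gamma>: "N2 * D1 - N1 * D2 \<le> 0"
    and \<beta>: "(N2 * D0 - N0 * D2)\<^sup>2 \<le> (N1 * D0 - N0 * D1) * (N2 * D1 - N1 * D2)"
    and N: "N0 \<le> \<phi> * D0"
  shows "N0 + N1 * (t * \<phi>) + N2 * (t * \<phi>)\<^sup>2 - t * N2
    \<le> \<phi> * (D0 + D1 * (t * \<phi>) + D2 * (t * \<phi>)\<^sup>2 - t * D2)"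
proof -
  define a where "a = N1 * D0 - N0 * D1"
  define b where "b = N2 * D0 - N0 * D2"
  define g where "g = N2 * D1 - N1 * D2"
  have ag: "a \<le> 0" "g \<le> 0" "b\<^sup>2 \<le> a * g" using \<alpha> \<beta> \<gamma> by (simp_all add: a_def b_def g_def)
  have pl: "D0 * g = D1 * b - D2 * a" by (simp add: a_def b_def g_def algebra_simps)
  \<comment> \<open>For \<open>D1 > 0\<close> the sign is read off the relation \<open>pl\<close>.
    For \<open>D1 = 0\<close> the discriminant forces \<open>D2 = 0\<close>, hence
    \<open>g = 0\<close> and then \<open>b = 0\<close>.\<close>
  have b: "b \<le> 0"
  proof (cases "D1 = 0")
    case True
    then have "D2 = 0" using D(1,3,4) by (simp add: mult_le_0_iff)
    then have "g = 0" using pl D(1) True by simp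
    then show ?thesis using ag by simp
  next
    case False
    have "D1 * b = D0 * g + D2 * a" using pl by simp
    also have "\<dots> \<le> 0" using D(1,3) ag by (intro add_nonpos_nonpos mult_nonneg_nonpos) auto
    finally show ?thesis using D(2) False by (simp add: mult_le_0_iff)
  qed
  have conv: "a * D1 \<le> b * D0"
  proof (cases "b = 0")
    case True then show ?thesis using ag D(2) by (simp add: mult_nonpos_nonneg)
  next
    case False
    then have "b < 0" using b by simp
    have "D0 * b\<^sup>2 \<le> D0 * (a * g)" using ag(3) D(1) by simp
    also have "\<dots> = a * (D0 * g)" by simp
    also have "\<dots> = a * (D1 * b) - a\<^sup>2 * D2" unfolding pl by (simp add: algebra_simps power2_eq_square)
    also have "\<dots> \<le> a * (D1 * b)" using D(3) by simp
    finally have "b * (b * D0) \<le> b * (a * D1)" by (simp add: power2_eq_square algebra_simps)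
    then show ?thesis using \<open>b < 0\<close> by simp
  qed
  define d where "d = t * \<phi>"
  have "d \<ge> 0" using t \<phi> by (simp add: d_def)
  \<comment> \<open>The left-hand side is the new numerator times \<open>D0\<close> minus
    \<open>N0\<close> times the new denominator: its sign says that the quotient has not grown. Only
    \<open>d\<^sup>2 < t\<close> needs convexity, through \<open>a * \<phi> \<le> b\<close>.\<close>
  have main: "d * a + (d\<^sup>2 - t) * b \<le> 0"
  proof (cases "d\<^sup>2 \<ge> t")
    case True
    then show ?thesis using ag b \<open>d \<ge> 0\<close> by (intro add_nonpos_nonpos mult_nonneg_nonpos) auto
  next
    case False
    have "a * (\<phi> * D0) \<le> a * D1" using D(5) ag by (intro mult_left_mono_neg) auto
    then have "D0 * (a * \<phi>) \<le> D0 * b" using conv by (simp add: algebra_simps)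
    then have "a * \<phi> \<le> b" using D(1) by simp
    then have "t * (a * \<phi>) \<le> t * b" using t by (intro mult_left_mono)
    moreover have "d\<^sup>2 * b \<le> 0" using b by (simp add: mult_nonneg_nonpos)
    ultimately show ?thesis by (simp add: d_def algebra_simps)
  qed
  let ?N = "N0 + N1 * d + N2 * d\<^sup>2 - t * N2" and ?D = "D0 + D1 * d + D2 * d\<^sup>2 - t * D2"
  have "?D > 0" unfolding d_def by (rule barrier_step_pos) (use assms in auto)
  have "?N * D0 - N0 * ?D = d * a + (d\<^sup>2 - t) * b"
    by (simp add: a_def b_def algebra_simps)
  then have "D0 * ?N \<le> N0 * ?D" using main by (simp add: mult.commute)
  also have "\<dots> \<le> (\<phi> * D0) * ?D" using N \<open>?D > 0\<close> by (intro mult_right_mono) auto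
  finally have "D0 * ?N \<le> D0 * (\<phi> * ?D)" by (simp add: mult_ac)
  then show ?thesis using D(1) unfolding d_def by simp
qed

section \<open>Loewner order and propagation of the barrier through the variables\<close>

definition loewner_le :: "real^'n^'n \<Rightarrow> real^'n^'n \<Rightarrow> bool" where
  "loewner_le A B \<longleftrightarrow> (\<forall>w. w \<bullet> (A *v w) \<le> w \<bullet> (B *v w))"

lemma loewner_le_add_rk: "loewner_le A B \<Longrightarrow> a \<ge> 0 \<Longrightarrow> loewner_le A (B + rk a v)"
  by (auto simp: loewner_le_def matrix_vector_mult_add_rdistrib inner_add_right rk_quadratic_form
      intro: order_trans)

lemma loewner_le_diff_rk: "loewner_le (A + rk a v) B \<Longrightarrow> loewner_le A (B - rk a v)"
  by (simp add: loewner_le_def matrix_vector_mult_add_rdistrib matrix_vector_mult_diff_rdistrib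
      inner_add_right inner_diff_right le_diff_eq)

lemma pos_def_loewner: "\<mu> > 0 \<Longrightarrow> loewner_le (mat \<mu>) M \<Longrightarrow> pos_def M"
  unfolding pos_def_def loewner_le_def mat_quadratic_form
  by (meson inner_gt_zero_iff less_le_trans mult_pos_pos)

lemma det_nonzero_pos_def:
  fixes M :: "real^'n^'n"
  assumes "pos_def M" shows "det M \<noteq> 0"
proof
  assume "det M = 0"
  then obtain w where "M *v w = 0" "w \<noteq> 0"
    unfolding det_eq_0_iff_kernel by blast
  then show False using assms unfolding pos_def_def by (metis inner_zero_right less_irrefl)
qed

text \<open>On the segment from the identity to \<open>M\<close> all matrices are positive definite,
  so the determinant cannot change sign.\<close>

lemma det_pos_pos_def:
  fixes M :: "real^'n^'n"
  assumes "pos_def M" shows "det M > 0"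
proof (rule ccontr)
  assume "\<not> det M > 0"
  define F where "F s = (1 - s) *\<^sub>R mat 1 + s *\<^sub>R M" for s :: real
  have "continuous_on {0..1} (\<lambda>s. det (F s))"
    unfolding det_def F_def
    by (intro continuous_on_sum continuous_on_mult continuous_on_prod continuous_on_const)
      (auto intro!: continuous_intros)
  moreover have "det (F 0) = 1" "det (F 1) \<le> 0" using \<open>\<not> det M > 0\<close> by (simp_all add: F_def)
  ultimately obtain s where s: "0 \<le> s" "s \<le> 1" "det (F s) = 0"
    using IVT2'[of "\<lambda>s. det (F s)" 1 0 0] by auto
  have "pos_def (F s)"
    unfolding pos_def_def
  proof (intro allI impI)
    fix w :: "real^'n" assume "w \<noteq> 0"
    have "w \<bullet> (F s *v w) = (1 - s) * (w \<bullet> w) + s * (w \<bullet> (M *v w))"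
      by (simp add: F_def matrix_vector_mult_add_rdistrib inner_add_right scaleR_matrix_vector_assoc[symmetric])
    moreover have "w \<bullet> w > 0" "w \<bullet> (M *v w) > 0" using assms \<open>w \<noteq> 0\<close> by (auto simp: pos_def_def)
    ultimately show "w \<bullet> (F s *v w) > 0"
      using s by (cases "s = 0") (auto intro!: add_nonneg_pos)
  qed
  then show False using det_nonzero_pos_def s by blast
qed

text \<open>The budget of the barrier argument: each variable consumes one shift by
  \<open>p * (1 - p) * \<phi>\<close> in its direction, and \<open>\<mu>\<close> is the margin left
  for the determinants themselves.\<close>

fun barrier_matrix :: "real \<Rightarrow> real \<Rightarrow> (real \<times> (real^'n)) list \<Rightarrow> real^'n^'n" where
  "barrier_matrix \<mu> \<phi> [] = mat \<mu>"
| "barrier_matrix \<mu> \<phi> ((p, v) # L) = barrier_matrix \<mu> \<phi> L + rk (p * (1 - p) * \<phi>) v"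

text \<open>In terms of the inverse, \<open>e / det M\<close> is the form of \<open>M^-1\<close> at
  \<open>v\<close>. The bounds follow without inverses: the affine function vanishes at
  \<open>z = - det M / e\<close>, where violating either bound would leave the matrix positive
  definite.\<close>

lemma det_derivative_bounds:
  fixes M :: "real^'n^'n"
  assumes "\<mu> > 0" "loewner_le (mat \<mu>) M" "norm v \<le> l" and e: "\<And>z. det (M + rk z v) = det M + e * z"
  shows "0 \<le> e" "e * \<mu> \<le> l\<^sup>2 * det M"
proof -
  have "det M > 0" using assms by (intro det_pos_pos_def pos_def_loewner)
  show "0 \<le> e"
  proof (rule ccontr)
    assume "\<not> 0 \<le> e"
    then have "pos_def (M + rk (- det M / e) v)"
      using assms \<open>det M > 0\<close> by (intro pos_def_add_rk pos_def_loewner) (auto simp: divide_nonneg_neg)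
    then have "det (M + rk (- det M / e) v) \<noteq> 0" by (rule det_nonzero_pos_def)
    then show False unfolding e using \<open>\<not> 0 \<le> e\<close> by simp
  qed
  show "e * \<mu> \<le> l\<^sup>2 * det M"
  proof (rule ccontr)
    assume *: "\<not> e * \<mu> \<le> l\<^sup>2 * det M"
    have "l\<^sup>2 * det M \<ge> 0" using \<open>det M > 0\<close> by simp
    then have "e > 0" using * \<open>0 \<le> e\<close> by (cases "e = 0") auto
    have "pos_def (M + rk (- det M / e) v)"
      unfolding pos_def_def
    proof (intro allI impI)
      fix w :: "real^'n" assume "w \<noteq> 0"
      have "(v \<bullet> w)\<^sup>2 \<le> (v \<bullet> v) * (w \<bullet> w)" by (rule Cauchy_Schwarz_ineq)
      also have "\<dots> \<le> l\<^sup>2 * (w \<bullet> w)"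
        using assms(3) by (intro mult_right_mono) (auto simp: dot_square_norm intro: power_mono)
      finally have 1: "det M / e * (v \<bullet> w)\<^sup>2 \<le> det M / e * (l\<^sup>2 * (w \<bullet> w))"
        using \<open>det M > 0\<close> \<open>e > 0\<close> by (intro mult_left_mono) auto
      have "det M / e * l\<^sup>2 < \<mu>" using * \<open>e > 0\<close> by (simp add: field_simps)
      then have "det M / e * l\<^sup>2 * (w \<bullet> w) < \<mu> * (w \<bullet> w)"
        using \<open>w \<noteq> 0\<close> by (intro mult_strict_right_mono) auto
      also have "\<dots> \<le> w \<bullet> (M *v w)" using assms(2) by (simp add: loewner_le_def mat_quadratic_form)
      finally show "w \<bullet> ((M + rk (- det M / e) v) *v w) > 0"
        using 1 by (simp add: matrix_vector_mult_add_rdistrib inner_add_right rk_quadratic_form mult_ac)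
    qed
    then have "det (M + rk (- det M / e) v) \<noteq> 0" by (rule det_nonzero_pos_def)
    then show False unfolding e using \<open>e > 0\<close> by simp
  qed
qed

text \<open>The invariant is positivity together with logarithmic derivatives in
  \<open>[0, \<phi>]\<close> for all directions of norm at most \<open>l\<close>. For the empty list
  the product of two determinants doubles the derivative, whence
  \<open>2 * l\<^sup>2 \<le> \<phi> * \<mu>\<close>.\<close>

lemma mixed_barrier:
  assumes "\<mu> > 0" "2 * l\<^sup>2 \<le> \<phi> * \<mu>" "valid l L" "symm M" "loewner_le (barrier_matrix \<mu> \<phi> L) M"
  shows "mixed L M M > 0"
    and "\<And>v g0 g1 g2. norm v \<le> l \<Longrightarrow> (\<And>u. mixed L (M + rk u v) (M + rk u v) = g0 + g1 * u + g2 * u\<^sup>2) \<Longrightarrow>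
      0 \<le> g1 \<and> g1 \<le> \<phi> * g0"
  using assms(3-)
proof (induction L arbitrary: M)
  case Nil
  { case 1
    then show ?case using assms(1) pos_def_loewner det_pos_pos_def by fastforce
  next
    case (2 v g0 g1 g2)
    obtain e where e: "\<And>z. det (M + rk z v) = det M + e * z"
      using det_rk_affine by metis
    have "det M > 0" using 2 assms(1) pos_def_loewner det_pos_pos_def by fastforce
    have e_bounds: "0 \<le> e" "e * \<mu> \<le> l\<^sup>2 * det M"
      using det_derivative_bounds[OF assms(1) _ 2(1) e] 2 by auto
    have "(det M)\<^sup>2 + (2 * det M * e) * u + e\<^sup>2 * u\<^sup>2 = g0 + g1 * u + g2 * u\<^sup>2" for u
      unfolding 2(2)[symmetric] by (simp add: e power2_eq_square algebra_simps)
    from quadratic_coeffs_unique[OF this] have g: "g0 = (det M)\<^sup>2" "g1 = 2 * det M * e" by auto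
    have "g1 * \<mu> = 2 * det M * (e * \<mu>)" by (simp add: g)
    also have "\<dots> \<le> 2 * det M * (l\<^sup>2 * det M)" using e_bounds \<open>det M > 0\<close> by (intro mult_left_mono) auto
    also have "\<dots> = (2 * l\<^sup>2) * (det M)\<^sup>2" by (simp add: power2_eq_square)
    also have "\<dots> \<le> \<phi> * \<mu> * (det M)\<^sup>2" using assms(2) by (intro mult_right_mono) auto
    finally have "g1 * \<mu> \<le> (\<phi> * g0) * \<mu>" by (simp add: g mult_ac)
    then show ?case using assms(1) e_bounds \<open>det M > 0\<close> by (simp add: g)
  }
next
  case (Cons x L)
  obtain p a where x: "x = (p, a)" by force
  define t where "t = p * (1 - p)"
  have "\<phi> \<ge> 0" using assms(1,2) by (smt (verit) zero_le_mult_iff zero_le_power2)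
  have step: "\<exists>g0 g1 g2. (\<forall>w. mixed (x # L) (M + rk w v) (M + rk w v) = g0 + g1 * w + g2 * w\<^sup>2) \<and>
      g0 > 0 \<and> g1 \<le> \<phi> * g0"
    if hyps: "valid l (x # L)" "symm M" "loewner_le (barrier_matrix \<mu> \<phi> (x # L)) M" "norm v \<le> l" for M v
  proof -
    have "t \<ge> 0" using hyps(1) by (simp add: x t_def)
    have "norm a \<le> l" "valid l L" using hyps(1) by (auto simp: x)
    \<comment> \<open>Going back by \<open>t * \<phi>\<close> reaches a point admissible for the
      shorter list; the barrier step then moves forward by the same amount. Below, \<open>D\<close>
      is the restriction to direction \<open>a\<close>, and \<open>N\<close> its derivative along
      \<open>v\<close>.\<close>
    define M' where "M' = M - rk (t * \<phi>) a"
    have M': "symm M'" "loewner_le (barrier_matrix \<mu> \<phi> L) M'"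
      using hyps by (auto simp: M'_def x t_def intro: loewner_le_diff_rk)
    define f where "f u w = mixed L (M' + rk u a + rk w v) (M' + rk u a + rk w v)" for u w
    have "M' + rk u a + rk w v = M' + rk w v + rk u a" for u w by simp
    then have "\<exists>a b c. \<forall>u. f u w = a + b * u + c * u\<^sup>2" for w
      unfolding f_def by (simp only: mixed_quadratic)
    moreover have "\<exists>a b c. \<forall>w. f u w = a + b * w + c * w\<^sup>2" for u
      unfolding f_def by (rule mixed_quadratic)
    ultimately obtain D0 D1 D2 N0 N1 N2 E0 E1 E2 where f:
      "\<And>u w. f u w = (D0 + D1 * u + D2 * u\<^sup>2) + (N0 + N1 * u + N2 * u\<^sup>2) * w + (E0 + E1 * u + E2 * u\<^sup>2) * w\<^sup>2"
      using biquadratic_expansion[of f] by metis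
    have D: "mixed L (M' + rk u a) (M' + rk u a) = D0 + D1 * u + D2 * u\<^sup>2" for u
      using f[of u 0] by (simp add: f_def)
    have N: "mixed L (M' + rk w v) (M' + rk w v) = D0 + N0 * w + E0 * w\<^sup>2" for w
      using f[of 0 w] by (simp add: f_def)
    have D0: "D0 > 0" using Cons.IH(1)[OF \<open>valid l L\<close> M'] D[of 0] by simp
    have D1: "0 \<le> D1 \<and> D1 \<le> \<phi> * D0"
      by (rule Cons.IH(2)[OF \<open>norm a \<le> l\<close> D \<open>valid l L\<close> M'])
    have N0: "0 \<le> N0 \<and> N0 \<le> \<phi> * D0"
      by (rule Cons.IH(2)[OF \<open>norm v \<le> l\<close> N \<open>valid l L\<close> M'])
    have D2: "D2 \<ge> 0"
    proof (rule quadratic_lead_nonneg)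
      show "D0 + D1 * w + D2 * w\<^sup>2 > 0" if "w \<ge> 0" for w
        unfolding D[symmetric] using \<open>valid l L\<close> M' that
        by (intro Cons.IH(1) loewner_le_add_rk symm_add) auto
    qed
    have disc: "4 * D0 * D2 \<le> D1\<^sup>2"
      by (rule mixed_discriminant_nonneg[OF M'(1) \<open>valid l L\<close> D])
    note signs = mixed_log_derivative_signs[OF M'(1) \<open>valid l L\<close> f[unfolded f_def]]
    have "mixed (x # L) (M + rk w v) (M + rk w v) =
        (D0 + D1 * (t * \<phi>) + D2 * (t * \<phi>)\<^sup>2 - t * D2) + (N0 + N1 * (t * \<phi>) + N2 * (t * \<phi>)\<^sup>2 - t * N2) * w
        + (E0 + E1 * (t * \<phi>) + E2 * (t * \<phi>)\<^sup>2 - t * E2) * w\<^sup>2" for w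
    proof -
      have "mixed L (M + rk w v + rk u a) (M + rk w v + rk u a) = f (t * \<phi>) w
          + (D1 + N1 * w + E1 * w\<^sup>2 + 2 * (t * \<phi>) * (D2 + N2 * w + E2 * w\<^sup>2)) * u
          + (D2 + N2 * w + E2 * w\<^sup>2) * u\<^sup>2" for u
      proof -
        have "M + rk w v + rk u a = M' + rk (t * \<phi> + u) a + rk w v"
          by (simp add: M'_def rk_add)
        then have "mixed L (M + rk w v + rk u a) (M + rk w v + rk u a) = f (t * \<phi> + u) w"
          by (simp only: f_def)
        also have "\<dots> = f (t * \<phi>) w + (D1 + N1 * w + E1 * w\<^sup>2 + 2 * (t * \<phi>) * (D2 + N2 * w + E2 * w\<^sup>2)) * u
          + (D2 + N2 * w + E2 * w\<^sup>2) * u\<^sup>2"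
          unfolding f by (simp add: power2_eq_square algebra_simps)
        finally show ?thesis .
      qed
      from mixed_Cons_eq[OF this, of p] show ?thesis
        unfolding x f t_def by (simp add: algebra_simps del: mixed.simps)
    qed
    moreover have "D0 + D1 * (t * \<phi>) + D2 * (t * \<phi>)\<^sup>2 - t * D2 > 0"
      using D0 D1 D2 disc \<open>t \<ge> 0\<close> \<open>\<phi> \<ge> 0\<close> by (intro barrier_step_pos) auto
    moreover have "N0 + N1 * (t * \<phi>) + N2 * (t * \<phi>)\<^sup>2 - t * N2
        \<le> \<phi> * (D0 + D1 * (t * \<phi>) + D2 * (t * \<phi>)\<^sup>2 - t * D2)"
      using D0 D1 D2 N0 disc \<open>t \<ge> 0\<close> \<open>\<phi> \<ge> 0\<close> signs by (intro barrier_step_deriv) auto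
    ultimately show ?thesis by blast
  qed
  have pos: "mixed (x # L) M M > 0"
    if "valid l (x # L)" "symm M" "loewner_le (barrier_matrix \<mu> \<phi> (x # L)) M" for M
  proof -
    have "norm a \<le> l" using that by (auto simp: x)
    from step[OF that this] obtain g0 g1 g2 where
      "\<And>w. mixed (x # L) (M + rk w a) (M + rk w a) = g0 + g1 * w + g2 * w\<^sup>2" "g0 > 0" by blast
    from this(1)[of 0] this(2) show ?thesis by simp
  qed
  { case 1
    then show ?case by (intro pos)
  next
    case (2 v g0 g1 g2)
    from step[OF 2(3-5) 2(1)] obtain h0 h1 h2 where h:
      "\<And>w. mixed (x # L) (M + rk w v) (M + rk w v) = h0 + h1 * w + h2 * w\<^sup>2" "h1 \<le> \<phi> * h0" by blast
    have "h0 + h1 * w + h2 * w\<^sup>2 = g0 + g1 * w + g2 * w\<^sup>2" for w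
      using h(1) 2(2) by metis
    note eq = quadratic_coeffs_unique[OF this]
    \<comment> \<open>The barrier step gives only the upper bound; the sign comes from positivity
      along the ray and real-rootedness.\<close>
    have "g1 \<ge> 0"
    proof (rule quadratic_linear_coeff_nonneg)
      show "g0 + g1 * w + g2 * w\<^sup>2 > 0" if "w \<ge> 0" for w
        unfolding 2(2)[symmetric] using 2(3-5) that
        by (intro pos loewner_le_add_rk symm_add) auto
      show "4 * g0 * g2 \<le> g1\<^sup>2"
        by (rule mixed_discriminant_nonneg[OF 2(4,3) 2(2)])
    qed
    then show ?case using h(2) eq by simp
  }
qed

section \<open>Real-rooted pencils\<close>

text \<open>As \<open>\<theta>\<close> decreases from \<open>x\<close> to \<open>0\<close>, zeros to
  the right of \<open>a\<close> cannot arise: none pass through \<open>a\<close>, none come from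
  beyond \<open>T\<close>, and none leave or enter the real axis. Formally, the parameters having
  such a zero form a subset of \<open>[0, x]\<close> that is closed with closed complement.\<close>

lemma real_rooted_pencil_no_new_roots:
  fixes F G :: "complex \<Rightarrow> complex" and f g :: "real \<Rightarrow> real"
  assumes hol: "F holomorphic_on UNIV" "G holomorphic_on UNIV"
    and re: "\<And>t. F (of_real t) = of_real (f t)" "\<And>t. G (of_real t) = of_real (g t)"
    and rr: "\<And>\<theta> z. 0 \<le> \<theta> \<Longrightarrow> \<theta> \<le> 1 \<Longrightarrow> Im z \<noteq> 0 \<Longrightarrow> of_real \<theta> * F z + of_real (1 - \<theta>) * G z \<noteq> 0"
    and large: "\<And>t. t \<ge> T \<Longrightarrow> f t > 0 \<and> g t > 0"
    and x: "0 \<le> x" "x \<le> 1"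
    and pos: "\<And>t. t \<ge> a \<Longrightarrow> x * f t + (1 - x) * g t > 0"
    and "g a > 0" "t \<ge> a"
  shows "g t > 0"
proof (rule ccontr)
  assume "\<not> g t > 0"
  define H where "H \<theta> t = \<theta> * f t + (1 - \<theta>) * g t" for \<theta> t
  define Hc where "Hc \<theta> z = of_real \<theta> * F z + of_real (1 - \<theta>) * G z" for \<theta> z
  have Hc: "Hc \<theta> (of_real t) = of_real (H \<theta> t)" for \<theta> t
    by (simp add: Hc_def H_def re)
  have "continuous_on UNIV (\<lambda>t. Re (C (of_real t)))" if "C holomorphic_on UNIV" for C
  proof -
    have "continuous_on UNIV (C \<circ> of_real)"
      using holomorphic_on_imp_continuous_on[OF that]
      by (intro continuous_on_compose) (auto intro: continuous_on_subset)
    then show ?thesis by (auto simp: o_def intro: continuous_on_Re)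
  qed
  from this[OF hol(1)] this[OF hol(2)]
have cont: "continuous_on UNIV f" "continuous_on UNIV g"
    by (simp_all add: re)
  \<comment> \<open>On \<open>[0, x]\<close>, the value at \<open>a\<close> interpolates linearly
    between the positive values for \<open>\<theta> = 0\<close> and
    \<open>\<theta> = x\<close>.\<close>
  have Ha: "H \<theta> a > 0" if "0 \<le> \<theta>" "\<theta> \<le> x" for \<theta>
  proof (cases "\<theta> = 0")
    case True then show ?thesis using \<open>g a > 0\<close> by (simp add: H_def)
  next
    case False
    have "x * H \<theta> a = \<theta> * (x * f a + (1 - x) * g a) + (x - \<theta>) * g a"
      by (simp add: H_def algebra_simps)
    also have "\<dots> > 0" using False that pos[of a] \<open>g a > 0\<close> by (intro add_pos_nonneg) auto
    finally show ?thesis using False that by (simp add: zero_less_mult_iff)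
  qed
  define Z where "Z = {\<theta> \<in> {0..x}. \<exists>t>a. H \<theta> t = 0}"
  \<comment> \<open>Zeros lie below \<open>T\<close> and never at \<open>a\<close>, so
    \<open>Z\<close> is the projection of a compact set although it is defined with the open
    condition \<open>t > a\<close>.\<close>
  have "Z = fst ` ({p \<in> {0..x} \<times> {a..T}. H (fst p) (snd p) = 0})"
  proof (intro set_eqI iffI)
    fix \<theta> assume "\<theta> \<in> Z"
    then obtain t where t: "0 \<le> \<theta>" "\<theta> \<le> x" "t > a" "H \<theta> t = 0" by (auto simp: Z_def)
    have "t < T"
    proof (rule ccontr)
      assume "\<not> t < T"
      then have "f t > 0" "g t > 0" using large by auto
      moreover have "0 \<le> \<theta>" "\<theta> \<le> 1" using t x by auto
      ultimately have "H \<theta> t > 0" unfolding H_def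
        by (cases "\<theta> = 0") (auto intro!: add_pos_nonneg)
      then show False using t by simp
    qed
    then show "\<theta> \<in> fst ` ({p \<in> {0..x} \<times> {a..T}. H (fst p) (snd p) = 0})"
      using t by (intro image_eqI[of _ _ "(\<theta>, t)"]) auto
  next
    fix \<theta> assume "\<theta> \<in> fst ` ({p \<in> {0..x} \<times> {a..T}. H (fst p) (snd p) = 0})"
    then obtain t where t: "0 \<le> \<theta>" "\<theta> \<le> x" "t \<ge> a" "H \<theta> t = 0" by auto
    then have "t \<noteq> a" using Ha by fastforce
    then show "\<theta> \<in> Z" using t by (auto simp: Z_def intro!: exI[of _ t])
  qed
  moreover have "continuous_on ({0..x} \<times> {a..T}) (\<lambda>p. H (fst p) (snd p))"
    unfolding H_def
    by (intro continuous_intros continuous_on_compose2[OF cont(1)] continuous_on_compose2[OF cont(2)]) auto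
  then have "closed {p \<in> {0..x} \<times> {a..T}. H (fst p) (snd p) = 0}"
    by (intro continuous_closed_preimage_constant closed_Times) auto
  then have "compact (({0..x} \<times> {a..T}) \<inter> {p \<in> {0..x} \<times> {a..T}. H (fst p) (snd p) = 0})"
    by (intro compact_Int_closed compact_Times) auto
  then have "compact {p \<in> {0..x} \<times> {a..T}. H (fst p) (snd p) = 0}"
    by (rule back_subst[of compact]) auto
  then have "compact (fst ` {p \<in> {0..x} \<times> {a..T}. H (fst p) (snd p) = 0})"
    by (intro compact_continuous_image continuous_intros)
  ultimately have "closed Z" by (simp add: compact_imp_closed)
  moreover have "closed ({0..x} - Z)"
    unfolding closed_sequential_limits
  proof (intro allI impI, elim conjE)
    fix \<theta> \<theta>0 assume \<theta>: "\<forall>n. \<theta> n \<in> {0..x} - Z" and lim: "\<theta> \<longlonglongrightarrow> \<theta>0"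
    have "\<theta>0 \<in> {0..x}"
      using \<theta> lim closed_sequentially[of "{0..x}" \<theta> \<theta>0] by auto
    moreover have "\<theta>0 \<notin> Z"
    proof
      assume "\<theta>0 \<in> Z"
      then obtain t0 where t0: "t0 > a" "H \<theta>0 t0 = 0" by (auto simp: Z_def)
      \<comment> \<open>The radius keeps the real points of the disc to the right of
        \<open>a\<close>, where the members with parameter outside \<open>Z\<close> do not vanish.
        Hurwitz's theorem transfers this to the limit.\<close>
      let ?S = "ball (complex_of_real t0) (t0 - a)"
      have "Hc \<theta>0 (of_real t0) \<noteq> 0"
      proof (rule Hurwitz_no_zeros[of ?S "\<lambda>n. Hc (\<theta> n)" "Hc \<theta>0"])
        have *: "Hc \<phi> holomorphic_on ?S" for \<phi>
          unfolding Hc_def by (intro holomorphic_intros holomorphic_on_subset[OF hol(1)] holomorphic_on_subset[OF hol(2)]) auto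
        show "Hc (\<theta> n) holomorphic_on ?S" for n by (rule *)
        show "Hc \<theta>0 holomorphic_on ?S" by (rule *)
        show "uniform_limit K (\<lambda>n. Hc (\<theta> n)) (Hc \<theta>0) sequentially" if "compact K" "K \<subseteq> ?S" for K
        proof (rule uniform_limitI)
          fix e :: real assume "e > 0"
          have "compact ((\<lambda>z. F z - G z) ` K)"
            by (intro compact_continuous_image continuous_intros \<open>compact K\<close>
                holomorphic_on_imp_continuous_on holomorphic_on_subset[OF hol(1)] holomorphic_on_subset[OF hol(2)]) auto
          then have "bounded ((\<lambda>z. F z - G z) ` K)" by (rule compact_imp_bounded)
          then obtain B where "B > 0" and B: "\<And>z. z \<in> K \<Longrightarrow> cmod (F z - G z) \<le> B"
            unfolding bounded_pos by blast
          have "\<forall>\<^sub>F n in sequentially. dist (\<theta> n) \<theta>0 < e / B"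
            using lim \<open>e > 0\<close> \<open>B > 0\<close> by (intro tendstoD) auto
          then show "\<forall>\<^sub>F n in sequentially. \<forall>z\<in>K. dist (Hc (\<theta> n) z) (Hc \<theta>0 z) < e"
          proof (eventually_elim, intro ballI)
            fix n z assume n: "dist (\<theta> n) \<theta>0 < e / B" and "z \<in> K"
            have "Hc (\<theta> n) z - Hc \<theta>0 z = of_real (\<theta> n - \<theta>0) * (F z - G z)"
              by (simp add: Hc_def algebra_simps)
            then have "dist (Hc (\<theta> n) z) (Hc \<theta>0 z) = \<bar>\<theta> n - \<theta>0\<bar> * cmod (F z - G z)"
              by (simp add: dist_norm norm_mult del: of_real_diff)
            also have "\<dots> \<le> \<bar>\<theta> n - \<theta>0\<bar> * B" using B[OF \<open>z \<in> K\<close>] by (intro mult_left_mono) auto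
            also have "\<dots> < e" using n \<open>B > 0\<close> by (simp add: dist_real_def field_simps)
            finally show "dist (Hc (\<theta> n) z) (Hc \<theta>0 z) < e" .
          qed
        qed
        show "\<not> Hc \<theta>0 constant_on ?S"
        proof
          assume "Hc \<theta>0 constant_on ?S"
          then obtain c where c: "\<And>z. z \<in> ?S \<Longrightarrow> Hc \<theta>0 z = c" by (auto simp: constant_on_def)
          have "Hc \<theta>0 (Complex t0 ((t0 - a) / 2)) = Hc \<theta>0 (of_real t0)"
          proof -
            have "Complex t0 ((t0 - a) / 2) - of_real t0 = Complex 0 ((t0 - a) / 2)"
              by (simp add: complex_eq_iff)
            then have "Complex t0 ((t0 - a) / 2) \<in> ?S"
              using t0(1) by (simp add: dist_norm norm_minus_commute[of "of_real t0"] complex_norm)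
            then show ?thesis using c t0(1) by simp
          qed
          also have "\<dots> = 0" unfolding Hc t0(2) by simp
          finally show False
            using rr[of \<theta>0 "Complex t0 ((t0 - a) / 2)"] \<open>\<theta>0 \<in> {0..x}\<close> x t0(1) by (simp add: Hc_def)
        qed
        show "Hc (\<theta> n) z \<noteq> 0" if "z \<in> ?S" for n z
        proof (cases "Im z = 0")
          case True
          then obtain t where z: "z = of_real t" by (metis complex_is_Real_iff Reals_cases)
          then have "t > a" using that by (simp add: dist_real_def dist_of_real)
          then show ?thesis using \<theta> unfolding z Hc Z_def by auto
        next
          case False
          then show ?thesis using rr[of "\<theta> n" z] \<theta> x unfolding Hc_def by (meson DiffD1 atLeastAtMost_iff order_trans)
        qed
      qed (use t0 in auto)
      then show False unfolding Hc t0(2) by simp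
    qed
    ultimately show "\<theta>0 \<in> {0..x} - Z" by simp
  qed
  moreover have "0 \<in> Z"
  proof -
    obtain s where "a \<le> s" "s \<le> t" "g s = 0"
      using IVT2'[of g t 0 a] \<open>\<not> g t > 0\<close> \<open>g a > 0\<close> \<open>t \<ge> a\<close> continuous_on_subset[OF cont(2)] by force
    moreover have "s \<noteq> a" using \<open>g s = 0\<close> \<open>g a > 0\<close> by auto
    ultimately show ?thesis using x by (auto simp: Z_def H_def intro!: exI[of _ s])
  qed
  moreover have "x \<in> {0..x} - Z"
    using x pos unfolding Z_def H_def by (fastforce dest: less_imp_le)
  moreover have "connected {0..x}" by simp
  ultimately show False
    using connected_closedD[of "{0..x}" Z "{0..x} - Z"] x by auto
qed

text \<open>Suppose both functions fail. At the leftmost of the two chosen failure points the other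
  one is positive, because the mixture is, and \<open>real_rooted_pencil_no_new_roots\<close> keeps
  it positive from there on.\<close>

lemma real_rooted_pencil_choice:
  fixes F G :: "complex \<Rightarrow> complex" and f g :: "real \<Rightarrow> real"
  assumes hol: "F holomorphic_on UNIV" "G holomorphic_on UNIV"
    and re: "\<And>t. F (of_real t) = of_real (f t)" "\<And>t. G (of_real t) = of_real (g t)"
    and rr: "\<And>\<theta> z. 0 \<le> \<theta> \<Longrightarrow> \<theta> \<le> 1 \<Longrightarrow> Im z \<noteq> 0 \<Longrightarrow> of_real \<theta> * F z + of_real (1 - \<theta>) * G z \<noteq> 0"
    and large: "\<And>t. t \<ge> T \<Longrightarrow> f t > 0 \<and> g t > 0"
    and x: "0 \<le> x" "x \<le> 1"
    and pos: "\<And>t. t \<ge> b \<Longrightarrow> x * f t + (1 - x) * g t > 0"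
  shows "(\<forall>t\<ge>b. f t > 0) \<or> (\<forall>t\<ge>b. g t > 0)"
proof (rule ccontr)
  assume "\<not> ?thesis"
  then obtain s t where st: "s \<ge> b" "\<not> f s > 0" "t \<ge> b" "\<not> g t > 0" by blast
  have one_pos: "f r > 0 \<or> g r > 0" if "r \<ge> b" for r
    using pos[OF that] x by (smt (verit) mult_nonneg_nonpos)
  show False
  proof (cases "s \<le> t")
    case True
    have "g t > 0"
      by (rule real_rooted_pencil_no_new_roots[OF hol re rr large x, where a = s])
        (use pos one_pos[of s] st True in auto)
    then show False using st by simp
  next
    case False
    have rr': "of_real \<theta> * G z + of_real (1 - \<theta>) * F z \<noteq> 0" if "0 \<le> \<theta>" "\<theta> \<le> 1" "Im z \<noteq> 0" for \<theta> z
      using rr[of "1 - \<theta>" z] that by (simp add: add.commute)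
    have "f s > 0"
      by (rule real_rooted_pencil_no_new_roots[OF hol(2,1) re(2,1) rr', where T = T and x = "1 - x" and a = t])
        (use large x pos one_pos[of t] st False in \<open>auto simp: add.commute\<close>)
    then show False using st by simp
  qed
qed

section \<open>Fixing the variables one at a time\<close>

lemma holomorphic_on_mixed:
  fixes F G :: "complex \<Rightarrow> complex^'n^'n"
  assumes "\<And>i j. (\<lambda>x. F x $ i $ j) holomorphic_on S" "\<And>i j. (\<lambda>x. G x $ i $ j) holomorphic_on S"
  shows "(\<lambda>x. mixed L (F x) (G x)) holomorphic_on S"
  using assms
proof (induction L arbitrary: F G)
  case Nil
  then show ?case unfolding mixed.simps det_def by (intro holomorphic_intros)
next
  case (Cons x L)
  obtain p v where x: "x = (p, v)" by force
  show ?case unfolding x mixed.simps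
    using Cons.prems by (intro holomorphic_intros Cons.IH) (auto intro!: holomorphic_on_add holomorphic_on_diff)
qed

text \<open>\<open>B\<close> enters only the real parts, so for \<open>Im z > 0\<close> stability
  applies with the imaginary part \<open>mat (Im z)\<close>; conjugation gives the lower
  half-plane.\<close>

lemma mixed_nonreal_nonzero:
  assumes "symm B" "valid l L" "Im z \<noteq> 0"
  shows "mixed L (cplx (mat (Re z) + B) (mat (Im z))) (cplx (mat (Re z) - B) (mat (Im z))) \<noteq> 0"
proof -
  have *: "mixed L (cplx (mat t + B) (mat y)) (cplx (mat t - B) (mat y)) \<noteq> 0" if "y > 0" for t y
    using assms that by (intro mixed_stable symm_add symm_diff) (auto simp: pos_def_def mat_quadratic_form)
  show ?thesis
  proof (cases "Im z > 0")
    case True then show ?thesis by (rule *)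
  next
    case False
    have "mat (Im z) = - (mat (- Im z) :: real^'a^'a)" by (simp add: mat_def vec_eq_iff)
    then show ?thesis
      using *[of "- Im z" "Re z"] False assms(3) by (simp only: mixed_cplx_cnj complex_cnj_zero_iff) simp
  qed
qed

lemma rk_shift:
  fixes M B :: "real^'n^'n"
  shows "M + B + rk a v = M + (B + rk a v)" "M - B - rk a v = M - (B + rk a v)"
    "M + B - rk a v = M + (B + rk (- a) v)" "M - B + rk a v = M - (B + rk (- a) v)"
  by (simp_all add: rk_minus)

text \<open>With the outcomes written as \<open>e - p\<close> for \<open>e = 1, 0\<close> and
  collected in \<open>B\<close>, the polynomial keeps its shape after each choice.\<close>

lemma mixed_Cons_shift:
  fixes M B :: "real^'n^'n"
  shows "mixed ((p, v) # L) (M + B) (M - B) =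
    p * mixed L (M + (B + rk (1 - p) v)) (M - (B + rk (1 - p) v))
    + (1 - p) * mixed L (M + (B + rk (0 - p) v)) (M - (B + rk (0 - p) v))"
  by (simp add: rk_shift)

lemma mixed_cplx_Cons_shift:
  "mixed ((p, v) # L) (cplx (M + B) Y) (cplx (M - B) Y) =
    of_real p * mixed L (cplx (M + (B + rk (1 - p) v)) Y) (cplx (M - (B + rk (1 - p) v)) Y)
    + of_real (1 - p) * mixed L (cplx (M + (B + rk (0 - p) v)) Y) (cplx (M - (B + rk (0 - p) v)) Y)"
  unfolding mixed.simps cplx_add_rk cplx_diff_rk by (simp add: rk_shift del: of_real_diff)

text \<open>Beyond the operator norm of \<open>B\<close> both matrices are positive definite; longer
  lists average such cases. This supplies the right-hand bound on zeros for the pencil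
  argument.\<close>

lemma mixed_eventually_pos:
  assumes "valid l L"
  shows "\<exists>T. \<forall>t\<ge>T. mixed L (mat t + B) (mat t - B) > (0::real)"
  using assms
proof (induction L arbitrary: B)
  case Nil
  define K where "K = onorm (\<lambda>w. B *v w)"
  have K: "\<bar>w \<bullet> (B *v w)\<bar> \<le> K * (w \<bullet> w)" for w
  proof -
    have "\<bar>w \<bullet> (B *v w)\<bar> \<le> norm w * norm (B *v w)" by (rule Cauchy_Schwarz_ineq2)
    also have "\<dots> \<le> norm w * (K * norm w)"
      unfolding K_def by (intro mult_left_mono onorm matrix_vector_mul_bounded_linear) auto
    finally show ?thesis by (simp add: dot_square_norm power2_eq_square mult_ac)
  qed
  have "pos_def (mat t + B) \<and> pos_def (mat t - B)" if "t \<ge> K + 1" for t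
  proof -
    have "\<bar>w \<bullet> (B *v w)\<bar> < t * (w \<bullet> w)" if "w \<noteq> 0" for w
    proof -
      have "K * (w \<bullet> w) < t * (w \<bullet> w)"
        using that \<open>t \<ge> K + 1\<close> by (intro mult_strict_right_mono) auto
      then show ?thesis using K[of w] by linarith
    qed
    then show ?thesis
      unfolding pos_def_def matrix_vector_mult_add_rdistrib matrix_vector_mult_diff_rdistrib
        inner_add_right inner_diff_right mat_quadratic_form
      by (smt (verit))
  qed
  then show ?case by (auto intro!: exI[of _ "K + 1"] mult_pos_pos det_pos_pos_def)
next
  case (Cons x L)
  obtain p v where x: "x = (p, v)" by force
  have p: "0 \<le> p" "p \<le> 1" "valid l L" using Cons.prems by (auto simp: x)
  obtain T1 where T1: "\<And>t. t \<ge> T1 \<Longrightarrow> mixed L (mat t + (B + rk (1 - p) v)) (mat t - (B + rk (1 - p) v)) > 0"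
    using Cons.IH p by blast
  obtain T2 where T2: "\<And>t. t \<ge> T2 \<Longrightarrow> mixed L (mat t + (B + rk (0 - p) v)) (mat t - (B + rk (0 - p) v)) > 0"
    using Cons.IH p by blast
  have "mixed (x # L) (mat t + B) (mat t - B) > 0" if "t \<ge> max T1 T2" for t
    unfolding x mixed_Cons_shift using T1[of t] T2[of t] that p
    by (cases "p = 0") (auto intro!: add_pos_nonneg)
  then show ?case by blast
qed

text \<open>The two outcomes of one variable form a real-rooted pencil: its members are again of the form
  \<open>mixed\<close>, with the probability \<open>p\<close> replaced by \<open>\<theta>\<close>.\<close>

lemma mixed_choice_step:
  assumes "symm B" "valid l ((p, v) # L)"
    and pos: "\<And>t. t \<ge> b \<Longrightarrow> mixed ((p, v) # L) (mat t + B) (mat t - B) > 0"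
  shows "\<exists>e\<in>{0, 1}. \<forall>t\<ge>b. mixed L (mat t + (B + rk (e - p) v)) (mat t - (B + rk (e - p) v)) > 0"
proof -
  let ?m = "\<lambda>e t. mixed L (mat t + (B + rk (e - p) v)) (mat t - (B + rk (e - p) v))"
  define K where "K C z = cplx (mat (Re z) + C) (mat (Im z))" for C :: "real^'a^'a" and z
  have K_eq: "K C z = mat z + cplx C 0" for C z
    by (simp add: K_def cplx_def mat_def vec_eq_iff complex_eq_iff)
  define F where "F e z = mixed L (K (B + rk (e - p) v) z) (K (- (B + rk (e - p) v)) z)" for e z
  have hol: "F e holomorphic_on UNIV" for e
  proof -
    have "(\<lambda>z. K C z $ i $ j) holomorphic_on UNIV" for C i j
      unfolding K_eq by (cases "i = j") (auto simp: mat_def intro!: holomorphic_intros)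
    then show ?thesis unfolding F_def by (intro holomorphic_on_mixed)
  qed
  have K_real: "K C (of_real t) = cplx (mat t + C) 0" for C t
    by (simp add: K_def mat_0)
  have re: "F e (of_real t) = of_real (?m e t)" for e t
    unfolding F_def K_real mixed_cplx_0 by (simp only: add_uminus_conv_diff)
  have rr: "of_real \<theta> * F 1 z + of_real (1 - \<theta>) * F 0 z \<noteq> 0"
    if "0 \<le> \<theta>" "\<theta> \<le> 1" "Im z \<noteq> 0" for \<theta> z
  proof -
    \<comment> \<open>Recentring by \<open>\<theta> - p\<close> keeps both outcomes fixed while the
      probability changes from \<open>p\<close> to \<open>\<theta>\<close>.\<close>
    let ?C = "B + rk (\<theta> - p) v"
    have "valid l ((\<theta>, v) # L)" using that assms(2) by auto
    then have "mixed ((\<theta>, v) # L) (cplx (mat (Re z) + ?C) (mat (Im z))) (cplx (mat (Re z) - ?C) (mat (Im z))) \<noteq> 0"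
      using assms(1) that by (intro mixed_nonreal_nonzero symm_add) auto
    moreover have "?C + rk (1 - \<theta>) v = B + rk (1 - p) v" "?C + rk (0 - \<theta>) v = B + rk (0 - p) v"
      unfolding add.assoc rk_add[symmetric] by simp_all
    ultimately show ?thesis
      unfolding F_def K_def mixed_cplx_Cons_shift
      by (simp only: add_uminus_conv_diff not_False_eq_True)
  qed
  have L: "valid l L" using assms(2) by auto
  obtain T0 where T0: "\<forall>t\<ge>T0. ?m 0 t > 0" using mixed_eventually_pos[OF L] by blast
  obtain T1 where T1: "\<forall>t\<ge>T1. ?m 1 t > 0" using mixed_eventually_pos[OF L] by blast
  have "p * ?m 1 t + (1 - p) * ?m 0 t > 0" if "t \<ge> b" for t
    using pos[OF that] unfolding mixed_Cons_shift .
  then have "(\<forall>t\<ge>b. ?m 1 t > 0) \<or> (\<forall>t\<ge>b. ?m 0 t > 0)"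
    using T0 T1 assms(2)
    by (intro real_rooted_pencil_choice[OF hol hol re re rr, of "max T0 T1" p]) auto
  then show ?thesis by auto
qed

lemma mixed_choice:
  fixes w :: "'i \<Rightarrow> real^'n" and x :: "'i \<Rightarrow> real"
  assumes "symm B" "valid l (map (\<lambda>i. (x i, w i)) I)" "distinct I"
    and "\<And>t. t \<ge> b \<Longrightarrow> mixed (map (\<lambda>i. (x i, w i)) I) (mat t + B) (mat t - B) > 0"
  shows "\<exists>z. (\<forall>i. z i \<in> {0, 1}) \<and> (\<forall>t\<ge>b.
    det (mat t + (B + (\<Sum>i\<in>set I. rk (z i - x i) (w i)))) * det (mat t - (B + (\<Sum>i\<in>set I. rk (z i - x i) (w i)))) > 0)"
  using assms
proof (induction I arbitrary: B)
  case Nil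
  then show ?case by (auto intro!: exI[of _ "\<lambda>_. 0"])
next
  case (Cons i js)
  from mixed_choice_step[OF Cons.prems(1) Cons.prems(2)[unfolded list.map] Cons.prems(4)[unfolded list.map]]
  obtain e where e: "e \<in> {0, 1}" "\<forall>t\<ge>b. mixed (map (\<lambda>i. (x i, w i)) js)
      (mat t + (B + rk (e - x i) (w i))) (mat t - (B + rk (e - x i) (w i))) > 0"
    by blast
  have "symm (B + rk (e - x i) (w i))" using Cons.prems(1) by auto
  from Cons.IH[OF this _ _ e(2)[rule_format]] Cons.prems obtain z where z: "\<And>i. z i \<in> {0, 1}"
    "\<And>t. t \<ge> b \<Longrightarrow> det (mat t + (B + rk (e - x i) (w i) + (\<Sum>i\<in>set js. rk (z i - x i) (w i))))
      * det (mat t - (B + rk (e - x i) (w i) + (\<Sum>i\<in>set js. rk (z i - x i) (w i)))) > 0"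
    by auto
  \<comment> \<open>Distinctness lets the value at \<open>i\<close> be overwritten without
    disturbing the choices for the rest of the list.\<close>
  have "(\<Sum>k\<in>set js. rk (((z(i := e)) k) - x k) (w k)) = (\<Sum>k\<in>set js. rk (z k - x k) (w k))"
    using Cons.prems(3) by (intro sum.cong) auto
  then have "(\<Sum>k\<in>set (i # js). rk ((z(i := e)) k - x k) (w k)) =
      rk (e - x i) (w i) + (\<Sum>k\<in>set js. rk (z k - x k) (w k))"
    using Cons.prems(3) by simp
  then show ?case
    using z e(1) by (intro exI[of _ "z(i := e)"]) (auto simp: add.assoc)
qed

section \<open>Rounding\<close>

text \<open>The maximum \<open>k\<close> of the form on the unit sphere is attained at an
  eigenvector, so \<open>det (mat k - S) = 0\<close> and hence \<open>k < b\<close>.\<close>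

lemma quadratic_form_le_of_det:
  fixes S :: "real^'n^'n"
  assumes "symm S" and det: "\<And>t. t \<ge> b \<Longrightarrow> det (mat t - S) \<noteq> 0"
  shows "w \<bullet> (S *v w) \<le> b * (w \<bullet> w)"
proof -
  have "continuous_on (sphere 0 1) (\<lambda>w. w \<bullet> (S *v w))"
    by (intro continuous_intros linear_continuous_on matrix_vector_mul_bounded_linear)
  moreover have "sphere 0 1 \<noteq> ({} :: (real^'n) set)" by simp
  ultimately obtain w0 where w0: "norm w0 = 1" and max: "\<And>w. norm w = 1 \<Longrightarrow> w \<bullet> (S *v w) \<le> w0 \<bullet> (S *v w0)"
    using continuous_attains_sup[of "sphere 0 1" "\<lambda>w. w \<bullet> (S *v w)"] by auto
  define k where "k = w0 \<bullet> (S *v w0)"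
  have le: "w \<bullet> (S *v w) \<le> k * (w \<bullet> w)" for w
  proof (cases "w = 0")
    case False
    let ?u = "(1 / norm w) *\<^sub>R w"
    have "?u \<bullet> (S *v ?u) \<le> k" unfolding k_def using False by (intro max) simp
    moreover have "?u \<bullet> (S *v ?u) = (w \<bullet> (S *v w)) / (w \<bullet> w)"
      by (simp add: matrix_vector_mult_scaleR dot_square_norm power2_eq_square)
    ultimately have "(w \<bullet> (S *v w)) / (w \<bullet> w) \<le> k" by linarith
    then show ?thesis using False by (simp add: divide_le_eq)
  qed auto
  define P where "P = mat k - S"
  have P: "u \<bullet> (P *v u) = k * (u \<bullet> u) - u \<bullet> (S *v u)" for u
    by (simp add: P_def matrix_vector_mult_diff_rdistrib inner_diff_right mat_quadratic_form)
  have "symm P" unfolding P_def using assms(1) by auto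
  have "P *v w0 = 0"
  proof (rule ccontr)
    assume "P *v w0 \<noteq> 0"
    define y where "y = P *v w0"
    define c where "c = y \<bullet> (P *v y)"
    \<comment> \<open>Since \<open>P\<close> is positive semidefinite and its form vanishes at
      \<open>w0\<close>, moving from \<open>w0\<close> by this negative multiple of
      \<open>P *v w0\<close> would make the form negative.\<close>
    define s where "s = - (y \<bullet> y) / (c + 1)"
    have "y \<bullet> y > 0" using \<open>P *v w0 \<noteq> 0\<close> by (simp add: y_def)
    have "c \<ge> 0" unfolding c_def P using le by simp
    have "w0 \<bullet> w0 = 1" using w0 by (simp add: dot_square_norm)
    then have "w0 \<bullet> (P *v w0) = 0" unfolding P by (simp add: k_def)
    then have "(w0 + s *\<^sub>R y) \<bullet> (P *v (w0 + s *\<^sub>R y)) = s * (2 * (y \<bullet> y) + s * c)"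
      using symm_inner[OF \<open>symm P\<close>, of w0 y]
      by (simp add: matrix_vector_right_distrib matrix_vector_mult_scaleR inner_add_left inner_add_right
          c_def y_def[symmetric] algebra_simps)
    moreover have "(w0 + s *\<^sub>R y) \<bullet> (P *v (w0 + s *\<^sub>R y)) \<ge> 0" unfolding P using le by simp
    moreover have "s < 0" unfolding s_def using \<open>y \<bullet> y > 0\<close> \<open>c \<ge> 0\<close> by (simp add: divide_neg_pos)
    moreover have "2 * (y \<bullet> y) + s * c > 0"
    proof -
      have "(y \<bullet> y) * (c / (c + 1)) \<le> (y \<bullet> y) * 1"
        using \<open>c \<ge> 0\<close> by (intro mult_left_mono) (auto simp: field_simps)
      then have "s * c \<ge> - (y \<bullet> y)" by (simp add: s_def)
      then show ?thesis using \<open>y \<bullet> y > 0\<close> by linarith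
    qed
    ultimately show False by (simp add: zero_le_mult_iff)
  qed
  moreover have "w0 \<noteq> 0" using w0 by auto
  ultimately have "det P = 0" unfolding det_eq_0_iff_kernel by blast
  then have "k < b" using det[of k] unfolding P_def by force
  then have "k * (w \<bullet> w) \<le> b * (w \<bullet> w)" by (intro mult_right_mono) auto
  then show ?thesis using le[of w] by linarith
qed

text \<open>Polarization bounds \<open>u \<bullet> (S *v w)\<close> when \<open>u\<close> and
  \<open>w\<close> have equal length; taking \<open>u\<close> parallel to \<open>S *v w\<close>
  turns this into a bound on the norm.\<close>

lemma op_norm_le_of_quadratic_form:
  assumes "symm S" and b: "\<And>w. \<bar>w \<bullet> (S *v w)\<bar> \<le> b * (w \<bullet> w)"
  shows "op_norm S \<le> b"
  unfolding op_norm_def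
proof (rule onorm_le)
  fix w
  show "norm (S *v w) \<le> b * norm w"
  proof (cases "w = 0 \<or> S *v w = 0")
    case True
    have "b \<ge> 0" if "w \<noteq> 0"
    proof -
      have "b * (w \<bullet> w) \<ge> 0" using b[of w] by linarith
      moreover have "w \<bullet> w > 0" using that by simp
      ultimately show ?thesis by (simp add: zero_le_mult_iff)
    qed
    then have "b * norm w \<ge> 0" by (cases "w = 0") auto
    then show ?thesis using True by auto
  next
    case False
    define r where "r = norm w / norm (S *v w)"
    define u where "u = r *\<^sub>R (S *v w)"
    have "norm u = norm w" using False by (simp add: u_def r_def)
    then have uu: "u \<bullet> u = w \<bullet> w" by (simp add: dot_square_norm)
    have "4 * (u \<bullet> (S *v w)) = (u + w) \<bullet> (S *v (u + w)) - (u - w) \<bullet> (S *v (u - w))"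
      using symm_inner[OF assms(1), of u w]
      by (simp add: matrix_vector_right_distrib matrix_vector_mult_diff_distrib
          inner_add_left inner_add_right inner_diff_left inner_diff_right)
    also have "\<dots> \<le> b * ((u + w) \<bullet> (u + w)) + b * ((u - w) \<bullet> (u - w))"
      using b[of "u + w"] b[of "u - w"] by linarith
    also have "\<dots> = 4 * (b * (w \<bullet> w))"
      by (simp add: inner_add_left inner_add_right inner_diff_left inner_diff_right uu inner_commute algebra_simps)
    finally have "u \<bullet> (S *v w) \<le> b * (w \<bullet> w)" by simp
    moreover have "u \<bullet> (S *v w) = norm w * norm (S *v w)"
      using False by (simp add: u_def r_def dot_square_norm power2_eq_square)
    ultimately have "norm w * norm (S *v w) \<le> norm w * (b * norm w)"
      by (simp add: dot_square_norm power2_eq_square mult_ac)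
    then show ?thesis using False by simp
  qed
qed

lemma matrix_vector_mult_sum_left: "(\<Sum>i\<in>I. A i) *v w = (\<Sum>i\<in>I. A i *v w)"
  by (induction I rule: infinite_finite_induct) (simp_all add: matrix_vector_mult_add_rdistrib)

lemma sum_rk_quadratic_form: "w \<bullet> ((\<Sum>i\<in>I. rk (a i) (v i)) *v w) = (\<Sum>i\<in>I. a i * (v i \<bullet> w)\<^sup>2)"
  by (simp add: matrix_vector_mult_sum_left inner_sum_right rk_quadratic_form)

lemma symm_sum_rk: "symm (\<Sum>i\<in>I. rk (a i) (v i))"
  by (simp add: symm_def rk_def mult_ac)

lemma barrier_matrix_quadratic_form:
  "w \<bullet> (barrier_matrix \<mu> \<phi> L *v w) = \<mu> * (w \<bullet> w) + \<phi> * (\<Sum>(p, v)\<leftarrow>L. p * (1 - p) * (v \<bullet> w)\<^sup>2)"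
  by (induction L)
    (auto simp: mat_quadratic_form matrix_vector_mult_add_rdistrib inner_add_right rk_quadratic_form algebra_simps)

text \<open>Since \<open>x i * (1 - x i) \<le> x i\<close>, the barrier matrix lies below
  \<open>\<mu> + \<phi> * \<Lambda>\<close> times the identity. Positivity from there on survives
  the choices, and the two determinants bound the final sum from both sides.\<close>

lemma rank_one_rounding:
  fixes w :: "'m::finite \<Rightarrow> real^'n" and x :: "'m \<Rightarrow> real"
  assumes x: "\<And>i. 0 \<le> x i \<and> x i \<le> 1" and w: "\<And>i. norm (w i) \<le> l"
    and \<Lambda>: "\<And>y. (\<Sum>i\<in>UNIV. x i * (w i \<bullet> y)\<^sup>2) \<le> \<Lambda> * (y \<bullet> y)"
    and \<mu>: "\<mu> > 0" "2 * l\<^sup>2 \<le> \<phi> * \<mu>"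
  shows "\<exists>z. (\<forall>i. z i \<in> {0, 1}) \<and>
    (\<forall>y. \<bar>\<Sum>i\<in>UNIV. (z i - x i) * (w i \<bullet> y)\<^sup>2\<bar> \<le> (\<mu> + \<phi> * \<Lambda>) * (y \<bullet> y))"
proof -
  define b where "b = \<mu> + \<phi> * \<Lambda>"
  obtain I :: "'m list" where I: "set I = UNIV" "distinct I"
    using finite_distinct_list[of "UNIV :: 'm set"] by auto
  define L where "L = map (\<lambda>i. (x i, w i)) I"
  have "valid l L" using x w by (auto simp: L_def)
  have "\<phi> \<ge> 0" using \<mu> by (smt (verit) zero_le_mult_iff zero_le_power2)
  have "loewner_le (barrier_matrix \<mu> \<phi> L) (mat t)" if "t \<ge> b" for t
    unfolding loewner_le_def
  proof
    fix y
    have "(\<Sum>(p, v)\<leftarrow>L. p * (1 - p) * (v \<bullet> y)\<^sup>2) = (\<Sum>i\<in>UNIV. x i * (1 - x i) * (w i \<bullet> y)\<^sup>2)"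
      unfolding L_def I(1)[symmetric]
      by (simp add: comp_def sum_list_distinct_conv_sum_set[OF I(2)])
    also have "\<dots> \<le> (\<Sum>i\<in>UNIV. x i * (w i \<bullet> y)\<^sup>2)"
    proof (intro sum_mono mult_right_mono)
      show "x i * (1 - x i) \<le> x i" for i using x[of i] by (simp add: mult_left_le)
    qed auto
    also have "\<dots> \<le> \<Lambda> * (y \<bullet> y)" by (rule \<Lambda>)
    finally have "y \<bullet> (barrier_matrix \<mu> \<phi> L *v y) \<le> \<mu> * (y \<bullet> y) + \<phi> * (\<Lambda> * (y \<bullet> y))"
      unfolding barrier_matrix_quadratic_form using \<open>\<phi> \<ge> 0\<close> by (intro add_left_mono mult_left_mono)
    also have "\<dots> = b * (y \<bullet> y)" by (simp add: b_def algebra_simps)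
    also have "\<dots> \<le> t * (y \<bullet> y)" using that by (intro mult_right_mono) auto
    finally show "y \<bullet> (barrier_matrix \<mu> \<phi> L *v y) \<le> y \<bullet> (mat t *v y)" by (simp add: mat_quadratic_form)
  qed
  then have pos: "mixed L (mat t + 0) (mat t - 0) > 0" if "t \<ge> b" for t
    using mixed_barrier(1)[OF \<mu> \<open>valid l L\<close> symm_mat, of t] that by simp
  have "symm (0 :: real^'n^'n)" by (simp add: symm_def)
  from mixed_choice[OF this \<open>valid l L\<close>[unfolded L_def] I(2) pos[unfolded L_def]]
  obtain z where z: "\<forall>i. z i \<in> {0, 1}" and
    det: "\<forall>t\<ge>b. det (mat t + (0 + (\<Sum>i\<in>UNIV. rk (z i - x i) (w i))))
      * det (mat t - (0 + (\<Sum>i\<in>UNIV. rk (z i - x i) (w i)))) > 0"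
    unfolding I(1) by blast
  define S where "S = (\<Sum>i\<in>UNIV. rk (z i - x i) (w i))"
  have det: "det (mat t - S) \<noteq> 0" "det (mat t - (- S)) \<noteq> 0" if "t \<ge> b" for t
    using det that by (auto simp: S_def)
  have "symm S" unfolding S_def by (rule symm_sum_rk)
  then have "symm (- S)" by (simp add: symm_def)
  have "\<bar>\<Sum>i\<in>UNIV. (z i - x i) * (w i \<bullet> y)\<^sup>2\<bar> \<le> b * (y \<bullet> y)" for y
  proof -
    have "y \<bullet> (S *v y) \<le> b * (y \<bullet> y)" by (rule quadratic_form_le_of_det[OF \<open>symm S\<close> det(1)])
    moreover have "y \<bullet> ((- S) *v y) \<le> b * (y \<bullet> y)" by (rule quadratic_form_le_of_det[OF \<open>symm (- S)\<close> det(2)])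
    moreover have "(- S) *v y = - (S *v y)"
      using matrix_vector_mult_diff_rdistrib[of 0 S y] by simp
    ultimately show ?thesis unfolding sum_rk_quadratic_form[symmetric] S_def[symmetric] by simp
  qed
  then show ?thesis using z b_def by blast
qed

section \<open>Reduction of the linear constraint to an extra coordinate\<close>

lemma rk_eq_outer: "rk a v = a *\<^sub>R outer v"
  by (simp add: rk_def outer_def vec_eq_iff)

lemma quadratic_form_le_op_norm: "w \<bullet> (A *v w) \<le> op_norm A * (w \<bullet> w)"
proof -
  have "w \<bullet> (A *v w) \<le> norm w * norm (A *v w)" by (rule norm_cauchy_schwarz)
  also have "\<dots> \<le> norm w * (op_norm A * norm w)"
    unfolding op_norm_def by (intro mult_left_mono onorm matrix_vector_mul_bounded_linear) auto
  finally show ?thesis by (simp add: dot_square_norm power2_eq_square mult_ac)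
qed

definition append_coord :: "real \<Rightarrow> real^'n \<Rightarrow> real^('n option)" where
  "append_coord s y = (\<chi> k. case k of None \<Rightarrow> s | Some j \<Rightarrow> y $ j)"

lemma inner_append_coord: "append_coord r v \<bullet> append_coord s y = r * s + v \<bullet> y"
  by (simp add: append_coord_def inner_vec_def UNIV_option_conv sum.reindex)

theorem theorem3p13:
  fixes v :: "'m::finite \<Rightarrow> real ^ 'n"
    and x c :: "real ^ 'm"
    and l lam :: real
  assumes "\<And>i. 0 \<le> x $ i \<and> x $ i \<le> 1"
    and "\<And>i. 0 \<le> c $ i"
    and "op_norm (\<Sum>i\<in>UNIV. (x $ i) *\<^sub>R outer (v i)) \<le> lam"
    and "\<And>i. norm (v i) \<le> l"
    and "(MAX i\<in>UNIV. c $ i) \<le> l\<^sup>2 * (c \<bullet> x) / lam"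
    and "l \<le> sqrt lam"
  shows "\<exists>z :: real ^ 'm. (\<forall>i. z $ i \<in> {0, 1}) \<and>
      op_norm ((\<Sum>i\<in>UNIV. (x $ i) *\<^sub>R outer (v i))
             - (\<Sum>i\<in>UNIV. (z $ i) *\<^sub>R outer (v i))) \<le> 8 * l * sqrt lam \<and>
      \<bar>c \<bullet> x - c \<bullet> z\<bar> \<le> 8 * l / sqrt lam * (c \<bullet> x)"
proof -
  have diff: "(\<Sum>i\<in>UNIV. (x $ i) *\<^sub>R outer (v i)) - (\<Sum>i\<in>UNIV. (z $ i) *\<^sub>R outer (v i))
      = (\<Sum>i\<in>UNIV. rk (x $ i - z $ i) (v i))" for z :: "real^'m"
    by (simp add: rk_eq_outer sum_subtractf[symmetric] scaleR_diff_left)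
  have c_le: "c $ i \<le> l\<^sup>2 * (c \<bullet> x) / lam" for i
    using assms(5) Max_ge[of "range (($) c)" "c $ i"] by auto
  have "l \<ge> 0" using assms(4)[of undefined] norm_ge_zero order_trans by blast
  show ?thesis
  \<comment> \<open>The barrier margin chosen below is a multiple of \<open>l\<close> and must be
    positive. For \<open>l = 0\<close> all \<open>v i\<close> and \<open>c\<close> vanish, so
    \<open>z = 0\<close> works.\<close>
  proof (cases "l = 0")
    case True
    then have "v i = 0" "c = 0" for i
      using assms(4)[of i] c_le assms(2) by (auto simp: vec_eq_iff order_antisym)
    then have "op_norm (\<Sum>i\<in>UNIV. rk (x $ i - 0 $ i) (v i)) = 0"
      by (simp add: op_norm_def rk_def onorm_zero zero_vec_def[symmetric])
    then show ?thesis
      using True \<open>c = 0\<close> unfolding diff by (intro exI[of _ 0]) auto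
  next
    case False
    then have "l > 0" using \<open>l \<ge> 0\<close> by simp
    then have "sqrt lam > 0" using assms(6) by linarith
    then have "lam > 0" by simp
    define s where "s = sqrt lam"
    have s: "s > 0" "s\<^sup>2 = lam" using \<open>sqrt lam > 0\<close> \<open>lam > 0\<close> by (simp_all add: s_def)
    have "c \<bullet> x \<ge> 0" using assms(1,2) by (simp add: inner_vec_def sum_nonneg)
    \<comment> \<open>If \<open>c \<bullet> x = 0\<close> then \<open>c = 0\<close>, and the junk value \<open>k = 0\<close> is harmless.\<close>
    define k where "k = lam / (c \<bullet> x)"
    have "k \<ge> 0" using \<open>lam > 0\<close> \<open>c \<bullet> x \<ge> 0\<close> by (simp add: k_def)
    have kc: "k * c $ i \<le> l\<^sup>2" for i
      using c_le[of i] \<open>lam > 0\<close> \<open>c \<bullet> x \<ge> 0\<close>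
      by (cases "c \<bullet> x = 0") (auto simp: k_def field_simps)
    have kcx: "k * (c \<bullet> x) \<le> lam" using \<open>lam > 0\<close> by (simp add: k_def)
    define w where "w i = append_coord (sqrt (k * c $ i)) (v i)" for i
    have w_inner: "w i \<bullet> append_coord r y = sqrt (k * c $ i) * r + v i \<bullet> y" for i r y
      by (simp add: w_def inner_append_coord)
    have sq: "(sqrt (k * c $ i))\<^sup>2 = k * c $ i" for i using \<open>k \<ge> 0\<close> assms(2) by simp
    have w_norm: "norm (w i) \<le> sqrt 2 * l" for i
    proof -
      have "v i \<bullet> v i \<le> l\<^sup>2" using assms(4)[of i] by (simp add: dot_square_norm power_mono)
      then have "w i \<bullet> w i \<le> l\<^sup>2 + l\<^sup>2"
        unfolding w_def inner_append_coord power2_eq_square[symmetric] sq using kc[of i] by linarith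
      also have "\<dots> = (sqrt 2 * l)\<^sup>2" by (simp add: power_mult_distrib)
      finally have "(norm (w i))\<^sup>2 \<le> (sqrt 2 * l)\<^sup>2" by (simp add: dot_square_norm)
      then show ?thesis by (rule power2_le_imp_le) (use \<open>l > 0\<close> in auto)
    qed
    have lam2: "(\<Sum>i\<in>UNIV. x $ i * (w i \<bullet> y)\<^sup>2) \<le> (2 * lam) * (y \<bullet> y)" for y
    proof -
      obtain r u where y: "y = append_coord r u"
      proof
        show "y = append_coord (y $ None) (\<chi> j. y $ Some j)"
          by (simp add: append_coord_def vec_eq_iff split: option.split)
      qed
      have "x $ i * (w i \<bullet> y)\<^sup>2 \<le> 2 * (x $ i * (v i \<bullet> u)\<^sup>2) + 2 * k * r\<^sup>2 * (c $ i * x $ i)" for i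
      proof -
        \<comment> \<open>Mixed terms are absorbed at the price of a factor two, which is why
          \<open>lam\<close> doubles.\<close>
        have "(sqrt (k * c $ i) * r + v i \<bullet> u)\<^sup>2 \<le> 2 * (sqrt (k * c $ i) * r)\<^sup>2 + 2 * (v i \<bullet> u)\<^sup>2"
          using zero_le_power2[of "sqrt (k * c $ i) * r - v i \<bullet> u"]
          by (simp add: power2_sum power2_diff)
        also have "\<dots> = 2 * (v i \<bullet> u)\<^sup>2 + 2 * (k * c $ i * r\<^sup>2)"
          by (simp only: power_mult_distrib sq)
        finally have "x $ i * (w i \<bullet> y)\<^sup>2 \<le> x $ i * (2 * (v i \<bullet> u)\<^sup>2 + 2 * (k * c $ i * r\<^sup>2))"
          unfolding y w_inner using assms(1) by (intro mult_left_mono) auto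
        then show ?thesis by (simp add: algebra_simps)
      qed
      then have "(\<Sum>i\<in>UNIV. x $ i * (w i \<bullet> y)\<^sup>2) \<le>
          (\<Sum>i\<in>UNIV. 2 * (x $ i * (v i \<bullet> u)\<^sup>2) + 2 * k * r\<^sup>2 * (c $ i * x $ i))"
        by (rule sum_mono)
      also have "\<dots> = 2 * (\<Sum>i\<in>UNIV. x $ i * (v i \<bullet> u)\<^sup>2) + 2 * (r\<^sup>2 * (k * (c \<bullet> x)))"
        by (simp add: sum.distrib sum_distrib_left inner_vec_def mult_ac)
      also have "(\<Sum>i\<in>UNIV. x $ i * (v i \<bullet> u)\<^sup>2) \<le> lam * (u \<bullet> u)"
      proof -
        have "(\<Sum>i\<in>UNIV. x $ i * (v i \<bullet> u)\<^sup>2) = u \<bullet> ((\<Sum>i\<in>UNIV. x $ i *\<^sub>R outer (v i)) *v u)"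
          unfolding sum_rk_quadratic_form[symmetric] by (simp add: rk_eq_outer)
        also have "\<dots> \<le> op_norm (\<Sum>i\<in>UNIV. x $ i *\<^sub>R outer (v i)) * (u \<bullet> u)"
          by (rule quadratic_form_le_op_norm)
        also have "\<dots> \<le> lam * (u \<bullet> u)" using assms(3) by (intro mult_right_mono) auto
        finally show ?thesis .
      qed
      also have "r\<^sup>2 * (k * (c \<bullet> x)) \<le> r\<^sup>2 * lam" using kcx by (intro mult_left_mono) auto
      also have "2 * (lam * (u \<bullet> u)) + 2 * (r\<^sup>2 * lam) = (2 * lam) * (y \<bullet> y)"
        unfolding y inner_append_coord by (simp add: algebra_simps power2_eq_square)
      finally show ?thesis by simp
    qed
    \<comment> \<open>With \<open>\<mu> = 4 * l * s\<close> and \<open>\<phi> = l / s\<close> the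
      barrier condition is an equality, and the bound is
      \<open>4 * l * s + 2 * l * s = 6 * l * s\<close>, within the required
      \<open>8 * l * s\<close>.\<close>
    have "2 * (sqrt 2 * l)\<^sup>2 = l / s * (4 * l * s)"
      using s by (simp add: power_mult_distrib power2_eq_square)
    moreover have "4 * l * s > 0" using \<open>l > 0\<close> s by simp
    ultimately obtain z0 where z0: "\<And>i. z0 i \<in> {0, 1}" and z0_le:
      "\<And>y. \<bar>\<Sum>i\<in>UNIV. (z0 i - x $ i) * (w i \<bullet> y)\<^sup>2\<bar> \<le> (4 * l * s + l / s * (2 * lam)) * (y \<bullet> y)"
      using rank_one_rounding[OF assms(1) w_norm lam2, where \<mu> = "4 * l * s" and \<phi> = "l / s"] by auto
    define z :: "real^'m" where "z = (\<chi> i. z0 i)"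
    have "l / s * (2 * lam) = 2 * l * s" using s by (simp add: power2_eq_square flip: s(2))
    then have z_le: "\<bar>\<Sum>i\<in>UNIV. (z $ i - x $ i) * (w i \<bullet> y)\<^sup>2\<bar> \<le> 8 * l * s * (y \<bullet> y)" for y
    proof -
      have "(4 * l * s + l / s * (2 * lam)) * (y \<bullet> y) \<le> 8 * l * s * (y \<bullet> y)"
        unfolding \<open>l / s * (2 * lam) = 2 * l * s\<close> using \<open>l > 0\<close> s by (intro mult_right_mono) auto
      then show ?thesis using z0_le[of y] by (simp add: z_def)
    qed
    \<comment> \<open>Vectors with last coordinate \<open>0\<close> see only the original
      matrices.\<close>
    have "op_norm (\<Sum>i\<in>UNIV. rk (x $ i - z $ i) (v i)) \<le> 8 * l * s"
    proof (rule op_norm_le_of_quadratic_form[OF symm_sum_rk])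
      fix y
      have "y \<bullet> ((\<Sum>i\<in>UNIV. rk (x $ i - z $ i) (v i)) *v y) =
          - (\<Sum>i\<in>UNIV. (z $ i - x $ i) * (w i \<bullet> append_coord 0 y)\<^sup>2)"
        unfolding sum_rk_quadratic_form w_inner by (simp add: sum_negf[symmetric] algebra_simps)
      then show "\<bar>y \<bullet> ((\<Sum>i\<in>UNIV. rk (x $ i - z $ i) (v i)) *v y)\<bar> \<le> 8 * l * s * (y \<bullet> y)"
        using z_le[of "append_coord 0 y"] by (simp add: inner_append_coord)
    qed
    moreover have "\<bar>c \<bullet> x - c \<bullet> z\<bar> \<le> 8 * l / s * (c \<bullet> x)"
    proof (cases "c \<bullet> x = 0")
      case True
      then have "c = 0" using c_le assms(2) by (auto simp: vec_eq_iff intro: order_antisym)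
      then show ?thesis by simp
    next
      case False
      then have "c \<bullet> x > 0" using \<open>c \<bullet> x \<ge> 0\<close> by simp
      \<comment> \<open>The extra unit vector reads off the new diagonal entry, which is
        \<open>k\<close> times the error in the linear constraint.\<close>
      have "(\<Sum>i\<in>UNIV. (z $ i - x $ i) * (w i \<bullet> append_coord 1 0)\<^sup>2) = - (k * (c \<bullet> x - c \<bullet> z))"
        unfolding w_inner
        by (simp add: sq power_mult_distrib inner_vec_def sum_distrib_left sum_subtractf algebra_simps)
      then have "\<bar>k * (c \<bullet> x - c \<bullet> z)\<bar> \<le> 8 * l * s"
        using z_le[of "append_coord 1 0"] by (simp add: inner_append_coord)
      then have "k * \<bar>c \<bullet> x - c \<bullet> z\<bar> \<le> 8 * l * s" using \<open>k \<ge> 0\<close> by (simp add: abs_mult)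
      then have "lam * \<bar>c \<bullet> x - c \<bullet> z\<bar> \<le> 8 * l * s * (c \<bullet> x)"
        using \<open>c \<bullet> x > 0\<close> by (simp add: k_def field_simps)
      then have "s * (s * \<bar>c \<bullet> x - c \<bullet> z\<bar>) \<le> s * (8 * l * (c \<bullet> x))"
        by (simp add: s(2)[symmetric] power2_eq_square mult_ac)
      then have "s * \<bar>c \<bullet> x - c \<bullet> z\<bar> \<le> 8 * l * (c \<bullet> x)" using s(1) by simp
      then show ?thesis using s(1) by (simp add: field_simps)
    qed
    moreover have "\<forall>i. z $ i \<in> {0, 1}" using z0 by (simp add: z_def)
    ultimately show ?thesis unfolding diff s_def by blast
  qed
qed

end
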